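(* Let $H$ be a separable infinite-dimensional complex Hilbert space and let $\varphi : K(H)^+ \to [0,\infty]$ be a (not necessarily linear) map. Then the following conditions are equivalent: (1) There is a monotone increasing function $\alpha:\mathbb{N}_0\to[0,\infty)$ with $\alpha(0)=0$ such that $\varphi=\varphi_\alpha$, the non-linear trace of Choquet type associated with $\alpha$. (2) $\varphi$ is monotonic increasing additive on the spectrum, unitarily invariant, monotone, positively homogeneous and lower semi-continuous on $K(H)^+$ in norm; moreover $\varphi(a)<\infty$ for any finite rank operator $a\in F(H)^+$. (3) $\varphi$ is comonotonic additive on the spectrum, unitarily invariant, monotone, positively homogeneous and lower semi-continuous on $K(H)^+$ in norm; moreover $\varphi(a)<\infty$ for any finite rank operator $a\in F(H)^+$.
   Context: $\mathbb{N}_0=\{0,1,2,\dots\}$. $B(H)$ is the algebra of bounded linear operators on $H$; $K(H)^+$ is the set of positive compact operators and $F(H)^+$ the set of positive finite rank operators on $H$. Eigenvalue sequence: for $a\in K(H)^+$ write $a=\sum_{n=1}^\infty\lambda_n(a)p_n$ with $p_n$ mutually orthogonal one-dimensional projections and $\lambda_1(a)\ge\lambda_2(a)\ge\cdots$ the eigenvalues of $a$ in decreasing order counted with multiplicity, $\lambda_n(a)\to0$; if $a$ has infinite rank all $\lambda_n(a)\neq 0$ (only nonzero eigenvalues are listed), and if $a$ has finite rank the list of nonzero eigenvalues is completed by zeros. Non-linear trace of Choquet type: for monotone increasing $\alpha:\mathbb{N}_0\to[0,\infty)$ with $\alpha(0)=0$, $\varphi_\alpha:K(H)^+\to[0,\infty]$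 is $\varphi_\alpha(a)=\sum_{i=1}^\infty(\lambda_i(a)-\lambda_{i+1}(a))\,\alpha(i)$. Properties of $\varphi:K(H)^+\to[0,\infty]$: - unitarily invariant: $\varphi(uau^* )=\varphi(a)$ for all $a\in K(H)^+$ and all unitaries $u\in B(H)$; - monotone: $a\le b$ implies $\varphi(a)\le\varphi(b)$ for $a,b\in K(H)^+$; - positively homogeneous: $\varphi(ka)=k\varphi(a)$ for all $a\in K(H)^+$ and scalars $k\ge0$, with $0\cdot\infty=0$; - two real functions $f,g$ on a set $\Omega$ are comonotonic if $(f(s)-f(t))(g(s)-g(t))\ge0$ for all $s,t\in\Omega$; - comonotonic additive on the spectrum: $\varphi(f(a)+g(a))=\varphi(f(a))+\varphi(g(a))$ for all $a\in K(H)^+$ and all comonotonic $f,g\in C(\sigma(a))^+$ with $f(0)=g(0)=0$, where $C(\sigma(a))^+$ denotes the non-negative continuous functions on the spectrum $\sigma(a)$ and $f(a)$ is the functional calculus; - monotonic increasing additive on the spectrum: $\varphi(f(a)+g(a))=\varphi(f(a))+\varphi(g(a))$ for all $a\in K(H)^+$ and all monotone increasing $f,g\in C(\sigma(a))^+$ with $f(0)=g(0)=0$; - lower semi-continuous in norm: if $\varphi(a)<\infty$, then for every $\epsilon>0$ there is $\delta>0$ such that $x\in K(H)^+$ and $\|x-a\|<\delta$ imply $\varphi(a)-\epsilon<\varphi(x)$; if $\varphi(a)=\infty$, then for every $M>0$ there is $\delta>0$ such that $x\in K(H)^+$ and $\|x-a\|<\delta$ imply $M<\varphi(x)$. *)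

theory Defs
  imports "HOL-Analysis.Analysis"
begin

subsection \<open>Complex Hilbert spaces\<close>

text \<open>The inner product is linear in the first argument and conjugate-linear in the second.\<close>

class complex_hilbert_space = banach +
  fixes scaleC :: "complex \<Rightarrow> 'a \<Rightarrow> 'a"  (infixr \<open>*\<^sub>C\<close> 75)
    and cinner :: "'a \<Rightarrow> 'a \<Rightarrow> complex"
  assumes scaleC_add_right: "c *\<^sub>C (x + y) = c *\<^sub>C x + c *\<^sub>C y"
    and scaleC_add_left: "(c + d) *\<^sub>C x = c *\<^sub>C x + d *\<^sub>C x"
    and scaleC_scaleC: "c *\<^sub>C d *\<^sub>C x = (c * d) *\<^sub>C x"
    and scaleC_of_real: "complex_of_real r *\<^sub>C x = r *\<^sub>R x"
    and cinner_add_left: "cinner (x + y) z = cinner x z + cinner y z"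
    and cinner_scaleC_left: "cinner (c *\<^sub>C x) y = c * cinner x y"
    and cinner_commute: "cinner x y = cnj (cinner y x)"
    and cinner_self: "cinner x x = complex_of_real ((norm x)\<^sup>2)"

lemma scaleC_one: "1 *\<^sub>C x = (x :: 'a::complex_hilbert_space)"
  using scaleC_of_real [of 1 x] by simp

global_interpretation cvec: vector_space "scaleC :: complex \<Rightarrow> 'a \<Rightarrow> 'a::complex_hilbert_space"
  by unfold_locales (auto simp: scaleC_add_right scaleC_add_left scaleC_scaleC scaleC_one)

definition infinite_dimensional :: "'a::complex_hilbert_space itself \<Rightarrow> bool" where
  "infinite_dimensional _ \<longleftrightarrow> \<not> (\<exists>B :: 'a set. finite B \<and> cvec.span B = UNIV)"


subsection \<open>Operators\<close>

text \<open>
  The library type \<open>'a \<Rightarrow>\<^sub>L 'a\<close> consists of the bounded \<^emph>\<open>real\<close>-linear maps; \<open>B(H)\<close> is the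
  subset of complex-linear ones, and the norm of \<open>'a \<Rightarrow>\<^sub>L 'a\<close> is the operator norm.
\<close>

definition bop :: "('a::complex_hilbert_space \<Rightarrow>\<^sub>L 'a) set" where
  "bop = {a. \<forall>c x. blinfun_apply a (c *\<^sub>C x) = c *\<^sub>C blinfun_apply a x}"

definition adj :: "('a::complex_hilbert_space \<Rightarrow>\<^sub>L 'a) \<Rightarrow> ('a \<Rightarrow>\<^sub>L 'a)" where
  "adj a = (THE b. b \<in> bop \<and> (\<forall>x y. cinner (blinfun_apply a x) y = cinner x (blinfun_apply b y)))"

definition unitary :: "('a::complex_hilbert_space \<Rightarrow>\<^sub>L 'a) \<Rightarrow> bool" where
  "unitary u \<longleftrightarrow> u \<in> bop \<and> adj u o\<^sub>L u = id_blinfun \<and> u o\<^sub>L adj u = id_blinfun"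

definition positive :: "('a::complex_hilbert_space \<Rightarrow>\<^sub>L 'a) \<Rightarrow> bool" where
  "positive a \<longleftrightarrow> a \<in> bop \<and> (\<forall>x. cinner (blinfun_apply a x) x \<in> \<real>\<^sub>\<ge>\<^sub>0)"

definition compact_op :: "('a::complex_hilbert_space \<Rightarrow>\<^sub>L 'a) \<Rightarrow> bool" where
  "compact_op a \<longleftrightarrow> a \<in> bop \<and> compact (closure (blinfun_apply a ` cball 0 1))"

definition finite_rank :: "('a::complex_hilbert_space \<Rightarrow>\<^sub>L 'a) \<Rightarrow> bool" where
  "finite_rank a \<longleftrightarrow> a \<in> bop \<and> (\<exists>B. finite B \<and> range (blinfun_apply a) \<subseteq> cvec.span B)"

definition Kpos :: "('a::complex_hilbert_space \<Rightarrow>\<^sub>L 'a) set" where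
  "Kpos = {a. positive a \<and> compact_op a}"

definition Fpos :: "('a::complex_hilbert_space \<Rightarrow>\<^sub>L 'a) set" where
  "Fpos = {a. positive a \<and> finite_rank a}"

definition rank_one_projection :: "('a::complex_hilbert_space \<Rightarrow>\<^sub>L 'a) \<Rightarrow> bool" where
  "rank_one_projection p \<longleftrightarrow>
     p \<in> bop \<and> p o\<^sub>L p = p \<and> adj p = p \<and> cvec.dim (range (blinfun_apply p)) = 1"


subsection \<open>Spectrum and continuous functional calculus\<close>

definition spectrum :: "('a::complex_hilbert_space \<Rightarrow>\<^sub>L 'a) \<Rightarrow> complex set" where
  "spectrum a = {z. \<not> (\<exists>b \<in> bop. \<forall>x.
      blinfun_apply b (blinfun_apply a x - z *\<^sub>C x) = x \<and>
      blinfun_apply a (blinfun_apply b x) - z *\<^sub>C blinfun_apply b x = x)}"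

text \<open>
  Positive operators have real spectrum, so for them this is the spectrum itself, regarded as a
  subset of \<open>\<real>\<close>. Functions on the spectrum are represented by functions \<open>real \<Rightarrow> real\<close>
  of which only the values on this set matter.
\<close>

definition real_spectrum :: "('a::complex_hilbert_space \<Rightarrow>\<^sub>L 'a) \<Rightarrow> real set" where
  "real_spectrum a = {t. complex_of_real t \<in> spectrum a}"

definition op_power :: "('a::complex_hilbert_space \<Rightarrow>\<^sub>L 'a) \<Rightarrow> nat \<Rightarrow> ('a \<Rightarrow>\<^sub>L 'a)" where
  "op_power a n = ((\<lambda>b. a o\<^sub>L b) ^^ n) id_blinfun"

definition op_poly :: "real poly \<Rightarrow> ('a::complex_hilbert_space \<Rightarrow>\<^sub>L 'a) \<Rightarrow> ('a \<Rightarrow>\<^sub>L 'a)" where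
  "op_poly P a = (\<Sum>i\<le>degree P. coeff P i *\<^sub>R op_power a i)"

text \<open>
  Continuous functional calculus of a self-adjoint operator \<open>a\<close> for real-valued \<open>f\<close>: the
  continuous extension, from polynomials to \<open>C(\<sigma>(a))\<close> with the supremum norm, of the map
  sending a polynomial \<open>P\<close> to the operator \<open>P(a)\<close>.
\<close>

definition fun_calc :: "(real \<Rightarrow> real) \<Rightarrow> ('a::complex_hilbert_space \<Rightarrow>\<^sub>L 'a) \<Rightarrow> ('a \<Rightarrow>\<^sub>L 'a)" where
  "fun_calc f a = (THE b. \<exists>P :: nat \<Rightarrow> real poly.
      uniform_limit (real_spectrum a) (\<lambda>n. poly (P n)) f sequentially \<and>
      (\<lambda>n. op_poly (P n) a) \<longlonglongrightarrow> b)"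


subsection \<open>Eigenvalue sequence and the trace of Choquet type\<close>

text \<open>
  Sequences are indexed from 0, so \<open>eigval a n\<close> is \<open>\<lambda>\<^bsub>n+1\<^esub>(a)\<close>. The sequence is determined by
  \<open>a\<close>, whereas the projections are not (in particular those with coefficient 0 in the
  finite rank case are arbitrary). If \<open>a\<close> has infinite rank, all terms are nonzero, since a
  zero term would force all later terms to vanish. The series converges in operator norm.
\<close>

definition eigval :: "('a::complex_hilbert_space \<Rightarrow>\<^sub>L 'a) \<Rightarrow> nat \<Rightarrow> real" where
  "eigval a = (THE l. decseq l \<and> l \<longlonglongrightarrow> 0 \<and>
     (\<exists>p :: nat \<Rightarrow> ('a \<Rightarrow>\<^sub>L 'a).
        (\<forall>n. rank_one_projection (p n)) \<and>
        (\<forall>m n. m \<noteq> n \<longrightarrow> p m o\<^sub>L p n = 0) \<and>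
        (\<lambda>n. l n *\<^sub>R p n) sums a))"

definition choquet_trace :: "(nat \<Rightarrow> real) \<Rightarrow> ('a::complex_hilbert_space \<Rightarrow>\<^sub>L 'a) \<Rightarrow> ennreal" where
  "choquet_trace \<alpha> a = (\<Sum>n. ennreal ((eigval a n - eigval a (Suc n)) * \<alpha> (Suc n)))"


subsection \<open>Properties of maps on the positive compact operators\<close>

definition unitarily_invariant :: "(('a::complex_hilbert_space \<Rightarrow>\<^sub>L 'a) \<Rightarrow> ennreal) \<Rightarrow> bool" where
  "unitarily_invariant \<phi> \<longleftrightarrow> (\<forall>a \<in> Kpos. \<forall>u. unitary u \<longrightarrow> \<phi> (u o\<^sub>L a o\<^sub>L adj u) = \<phi> a)"

definition op_monotone :: "(('a::complex_hilbert_space \<Rightarrow>\<^sub>L 'a) \<Rightarrow> ennreal) \<Rightarrow> bool" where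
  "op_monotone \<phi> \<longleftrightarrow> (\<forall>a \<in> Kpos. \<forall>b \<in> Kpos. positive (b - a) \<longrightarrow> \<phi> a \<le> \<phi> b)"

definition positively_homogeneous :: "(('a::complex_hilbert_space \<Rightarrow>\<^sub>L 'a) \<Rightarrow> ennreal) \<Rightarrow> bool" where
  "positively_homogeneous \<phi> \<longleftrightarrow>
     (\<forall>a \<in> Kpos. \<forall>k::real. 0 \<le> k \<longrightarrow> \<phi> (k *\<^sub>R a) = ennreal k * \<phi> a)"

definition comonotonic_on :: "'b set \<Rightarrow> ('b \<Rightarrow> real) \<Rightarrow> ('b \<Rightarrow> real) \<Rightarrow> bool" where
  "comonotonic_on \<Omega> f g \<longleftrightarrow> (\<forall>s \<in> \<Omega>. \<forall>t \<in> \<Omega>. 0 \<le> (f s - f t) * (g s - g t))"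

definition spec_funs :: "('a::complex_hilbert_space \<Rightarrow>\<^sub>L 'a) \<Rightarrow> (real \<Rightarrow> real) set" where
  "spec_funs a = {f. continuous_on (real_spectrum a) f \<and> (\<forall>t \<in> real_spectrum a. 0 \<le> f t) \<and> f 0 = 0}"

definition comonotonic_additive :: "(('a::complex_hilbert_space \<Rightarrow>\<^sub>L 'a) \<Rightarrow> ennreal) \<Rightarrow> bool" where
  "comonotonic_additive \<phi> \<longleftrightarrow>
     (\<forall>a \<in> Kpos. \<forall>f \<in> spec_funs a. \<forall>g \<in> spec_funs a. comonotonic_on (real_spectrum a) f g \<longrightarrow>
        \<phi> (fun_calc f a + fun_calc g a) = \<phi> (fun_calc f a) + \<phi> (fun_calc g a))"

definition monotonic_increasing_additive :: "(('a::complex_hilbert_space \<Rightarrow>\<^sub>L 'a) \<Rightarrow> ennreal) \<Rightarrow> bool" where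
  "monotonic_increasing_additive \<phi> \<longleftrightarrow>
     (\<forall>a \<in> Kpos. \<forall>f \<in> spec_funs a. \<forall>g \<in> spec_funs a.
        mono_on (real_spectrum a) f \<and> mono_on (real_spectrum a) g \<longrightarrow>
        \<phi> (fun_calc f a + fun_calc g a) = \<phi> (fun_calc f a) + \<phi> (fun_calc g a))"

text \<open>
  Subtraction on \<open>ennreal\<close> is truncated at 0, hence \<open>\<phi> a < \<phi> x + \<epsilon>\<close> instead of
  \<open>\<phi> a - \<epsilon> < \<phi> x\<close>.
\<close>

definition lower_semicontinuous :: "(('a::complex_hilbert_space \<Rightarrow>\<^sub>L 'a) \<Rightarrow> ennreal) \<Rightarrow> bool" where
  "lower_semicontinuous \<phi> \<longleftrightarrow> (\<forall>a \<in> Kpos.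
     (\<phi> a < \<infinity> \<longrightarrow> (\<forall>\<epsilon>::real > 0. \<exists>\<delta>::real > 0. \<forall>x \<in> Kpos.
        norm (x - a) < \<delta> \<longrightarrow> \<phi> a < \<phi> x + ennreal \<epsilon>)) \<and>
     (\<phi> a = \<infinity> \<longrightarrow> (\<forall>M::real > 0. \<exists>\<delta>::real > 0. \<forall>x \<in> Kpos.
        norm (x - a) < \<delta> \<longrightarrow> ennreal M < \<phi> x)))"

end

theory Submission
  imports Defs
begin

text \<open>
  Every positive compact \<open>a\<close> is diagonal, \<open>a = \<Sum>\<^sub>n l\<^sub>n p\<^sub>n\<close>, with decreasing \<open>l\<close>, and then
  \<open>f(a) = \<Sum>\<^sub>n f(l\<^sub>n) p\<^sub>n\<close> whenever \<open>f(0) = 0\<close>. By Abel summation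
  \<open>\<phi>\<^sub>\<alpha>(a) = \<Sum>\<^sub>n l\<^sub>n (\<alpha>(n + 1) - \<alpha>(n))\<close> (indices from 0), a series with nonnegative weights;
  monotonicity and lower semicontinuity follow from the minimax comparison of eigenvalues, and
  comonotonic additivity from rearranging \<open>f(l\<^sub>n)\<close> and \<open>g(l\<^sub>n)\<close> by one enumeration that sorts their
  sum. Conversely, \<open>\<alpha>(n)\<close> has to be the value of \<open>\<phi>\<close> at the projections of rank \<open>n\<close>; writing \<open>a\<close>
  as a limit of sums of monotone functions of \<open>a\<close> that are multiples of such projections
  determines \<open>\<phi>(a)\<close>.
\<close>

subsection \<open>Geometry of complex Hilbert spaces\<close>

text \<open>Diagonal operators are built over orthonormal sequences that need not be complete: an
  operator of infinite rank may have a nontrivial kernel although all its listed eigenvalues are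
  nonzero. This is where \<open>f 0 = 0\<close> matters: f(a) then also vanishes off the
  eigenvectors and is diagonal over the same sequence. Eigenvectors are not unique, so everything
  rests on one inequality between eigenvalues with an additive error c. For c = 0 it gives both
  uniqueness of the eigenvalue sequence and monotonicity; for c the norm of a difference it gives
  lower semicontinuity. The defining series is unsuited to it, because a gap between consecutive
  eigenvalues does not grow with the operator; Abel summation moves the differences from the
  eigenvalues to \<alpha>. In the converse direction additivity reaches finite sums only. The
  spectrum is therefore shifted down by the k-th eigenvalue; the part lost has norm at most that
  eigenvalue, and monotonicity together with lower semicontinuity recovers the limit.\<close>

lemma cinner_add_right: "cinner x (y + z) = cinner x y + cinner x z"
  by (metis cinner_add_left cinner_commute complex_cnj_add)

lemma cinner_scaleC_right: "cinner x (c *\<^sub>C y) = cnj c * cinner x y"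
  by (metis cinner_commute cinner_scaleC_left complex_cnj_mult)

lemma cinner_scaleR_left: "cinner (r *\<^sub>R x) y = of_real r * cinner x y"
  by (metis cinner_scaleC_left scaleC_of_real)

lemma cinner_scaleR_right: "cinner x (r *\<^sub>R y) = of_real r * cinner x y"
  by (metis cinner_scaleC_right scaleC_of_real complex_cnj_complex_of_real)

lemma cinner_minus_left: "cinner (- x) y = - cinner x y"
  using cinner_scaleR_left[of "-1" x y] by simp

lemma cinner_minus_right: "cinner x (- y) = - cinner x y"
  using cinner_scaleR_right[of x "-1" y] by simp

lemma cinner_diff_left: "cinner (x - y) z = cinner x z - cinner y z"
  using cinner_add_left[of x "- y" z] by (simp add: cinner_minus_left)

lemma cinner_diff_right: "cinner x (y - z) = cinner x y - cinner x z"
  using cinner_add_right[of x y "- z"] by (simp add: cinner_minus_right)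

lemma cinner_zero_left [simp]: "cinner 0 y = 0"
  using cinner_diff_left[of 0 0 y] by simp

lemma cinner_zero_right [simp]: "cinner x 0 = 0"
  using cinner_diff_right[of x 0 0] by simp

lemma cinner_sum_left: "cinner (\<Sum>i\<in>F. f i) y = (\<Sum>i\<in>F. cinner (f i) y)"
  by (induction F rule: infinite_finite_induct) (auto simp: cinner_add_left)

lemma cinner_sum_right: "cinner y (\<Sum>i\<in>F. f i) = (\<Sum>i\<in>F. cinner y (f i))"
  by (induction F rule: infinite_finite_induct) (auto simp: cinner_add_right)

lemmas cinner_simps = cinner_add_left cinner_add_right cinner_diff_left cinner_diff_right
  cinner_scaleR_left cinner_scaleR_right cinner_scaleC_left cinner_scaleC_right
  cinner_minus_left cinner_minus_right

lemma cnj_cinner: "cnj (cinner x y) = cinner y x"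
  by (rule cinner_commute[symmetric])

lemma norm_sq_cinner: "(norm x)\<^sup>2 = Re (cinner x x)"
  by (simp add: cinner_self)

lemma cinner_eqI:
  assumes "\<And>x. cinner x y = cinner x z"
  shows "y = z"
proof -
  have "cinner (y - z) (y - z) = 0"
    using assms by (simp add: cinner_diff_right)
  then show ?thesis by (simp add: cinner_self)
qed

text \<open>The normed space structure supplies homogeneity for real scalars only; the complex case
  has to come from the inner product.\<close>

lemma norm_scaleC: "norm (c *\<^sub>C x) = cmod c * norm x"
proof -
  have "complex_of_real ((norm (c *\<^sub>C x))\<^sup>2) = of_real ((cmod c * norm x)\<^sup>2)"
    by (simp only: cinner_self[symmetric] cinner_scaleC_left cinner_scaleC_right power_mult_distrib
        of_real_mult complex_norm_square mult_ac)
  then have "(norm (c *\<^sub>C x))\<^sup>2 = (cmod c * norm x)\<^sup>2"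
    by (simp only: of_real_eq_iff)
  then show ?thesis by simp
qed

lemma scaleC_zero_left [simp]: "0 *\<^sub>C x = (0::'a::complex_hilbert_space)"
  using norm_scaleC[of 0 x] by simp

lemma scaleC_zero_right [simp]: "c *\<^sub>C 0 = (0::'a::complex_hilbert_space)"
  using norm_scaleC[of c 0] by simp

lemma scaleC_scaleR_commute: "c *\<^sub>C r *\<^sub>R x = r *\<^sub>R c *\<^sub>C (x::'a::complex_hilbert_space)"
  by (metis mult.commute scaleC_of_real scaleC_scaleC)

lemma scaleC_scaleR_left: "(r *\<^sub>R c) *\<^sub>C x = r *\<^sub>R c *\<^sub>C (x::'a::complex_hilbert_space)"
  by (metis scaleR_conv_of_real scaleC_of_real scaleC_scaleC)

lemma norm_add_sq: "(norm (x + y))\<^sup>2 = (norm x)\<^sup>2 + (norm y)\<^sup>2 + 2 * Re (cinner x y)"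
proof -
  have "Re (cinner y x) = Re (cinner x y)"
    by (subst cinner_commute) simp
  then show ?thesis by (simp add: norm_sq_cinner cinner_simps)
qed

lemma norm_diff_sq: "(norm (x - y))\<^sup>2 = (norm x)\<^sup>2 + (norm y)\<^sup>2 - 2 * Re (cinner x y)"
  using norm_add_sq[of x "- y"] by (simp add: cinner_simps)

lemma cinner_cauchy_schwarz: "cmod (cinner x y) \<le> norm x * norm y"
proof (cases "y = 0")
  case False
  define c where "c = cinner x y / of_real ((norm y)\<^sup>2)"
  have ny: "norm y > 0" using False by simp
  have cr: "cnj c * cinner x y = of_real ((cmod (cinner x y))\<^sup>2 / (norm y)\<^sup>2)"
    unfolding c_def by (simp only: complex_cnj_divide complex_cnj_complex_of_real of_real_divide
        complex_norm_square times_divide_eq_left times_divide_eq_right mult.commute)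
  have "0 \<le> (norm (x - c *\<^sub>C y))\<^sup>2" by simp
  also have "\<dots> = (norm x)\<^sup>2 + (cmod c * norm y)\<^sup>2 - 2 * ((cmod (cinner x y))\<^sup>2 / (norm y)\<^sup>2)"
    by (simp only: norm_diff_sq norm_scaleC cinner_scaleC_right cr Re_complex_of_real)
  also have "(cmod c * norm y)\<^sup>2 = (cmod (cinner x y))\<^sup>2 / (norm y)\<^sup>2"
  proof -
    have "cmod c = cmod (cinner x y) / (norm y)\<^sup>2" by (simp add: c_def norm_divide norm_power)
    then show ?thesis using ny by (simp add: power2_eq_square)
  qed
  finally have "(cmod (cinner x y))\<^sup>2 / (norm y)\<^sup>2 \<le> (norm x)\<^sup>2" by simp
  then have "(cmod (cinner x y))\<^sup>2 \<le> (norm x * norm y)\<^sup>2"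
    using ny by (simp add: field_simps power_mult_distrib)
  then show ?thesis by (rule power2_le_imp_le) simp
qed simp

lemma bounded_bilinear_cinner: "bounded_bilinear (cinner :: 'a::complex_hilbert_space \<Rightarrow> _)"
proof
  show "\<exists>K. \<forall>a b. norm (cinner a b) \<le> norm a * norm (b::'a) * K"
    by (rule exI[of _ 1]) (simp add: cinner_cauchy_schwarz)
qed (auto simp: cinner_simps scaleR_conv_of_real)

lemma bounded_bilinear_scaleC: "bounded_bilinear (scaleC :: complex \<Rightarrow> 'a::complex_hilbert_space \<Rightarrow> 'a)"
proof
  show "\<exists>K. \<forall>a b. norm (a *\<^sub>C b) \<le> norm a * norm (b::'a) * K"
    by (rule exI[of _ 1]) (simp add: norm_scaleC)
qed (auto simp: scaleC_add_left scaleC_add_right scaleC_scaleR_commute scaleC_scaleR_left)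

lemmas tendsto_scaleC = bounded_bilinear.tendsto[OF bounded_bilinear_scaleC]

lemma scaleC_sum_right: "c *\<^sub>C (\<Sum>i\<in>F. f i) = (\<Sum>i\<in>F. c *\<^sub>C (f i :: 'a::complex_hilbert_space))"
  by (induction F rule: infinite_finite_induct) (auto simp: scaleC_add_right)

lemma scaleC_diff_right: "c *\<^sub>C (x - y) = c *\<^sub>C x - c *\<^sub>C (y::'a::complex_hilbert_space)"
  using bounded_bilinear.diff_right[OF bounded_bilinear_scaleC] .

section \<open>Riesz representation and adjoints\<close>

text \<open>The representing vector minimises \<open>\<parallel>x\<parallel>\<^sup>2 - 2 Re (g x)\<close>.\<close>

lemma riesz_representation:
  fixes g :: "'a::complex_hilbert_space \<Rightarrow> complex"
  assumes bl: "bounded_linear g" and hom: "\<And>c x. g (c *\<^sub>C x) = c * g x"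
  shows "\<exists>y. \<forall>x. g x = cinner x y"
proof -
  interpret g: bounded_linear g by fact
  define J where "J x = (norm x)\<^sup>2 - 2 * Re (g x)" for x
  obtain K where K: "\<And>x. norm (g x) \<le> norm x * K" using g.bounded by blast
  have lb: "- K\<^sup>2 \<le> J x" for x
  proof -
    have "Re (g x) \<le> norm x * K" using K[of x] complex_Re_le_cmod order_trans by blast
    moreover have "0 \<le> (norm x - K)\<^sup>2" by simp
    ultimately show ?thesis unfolding J_def by (simp add: power2_eq_square algebra_simps)
  qed
  have bdd: "bdd_below (range J)" using lb by (auto intro!: bdd_belowI)
  define m where "m = Inf (range J)"
  have mle: "m \<le> J x" for x unfolding m_def using bdd by (simp add: cInf_lower)
  have "\<exists>x. J x < m + 1 / real (Suc n)" for n
  proof -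
    have "Inf (range J) < m + 1 / real (Suc n)" unfolding m_def by simp
    then show ?thesis using bdd by (subst (asm) cInf_less_iff) auto
  qed
  then obtain X where X: "\<And>n. J (X n) < m + 1 / real (Suc n)" by metis
  \<comment> \<open>Parallelogram identity, in which the linear part of \<open>J\<close> cancels.
    Since \<open>J\<close> at the midpoint is at least \<open>m\<close>, two near-minimisers with
    errors u and v have squared distance below 2(u + v); hence the quarter of the squared
    \<open>e\<close> in the choice of \<open>N\<close>.\<close>
  have par: "(norm (x - y))\<^sup>2 = 2 * (J x + J y - 2 * J ((1/2) *\<^sub>R (x + y)))" for x y
  proof -
    have "(norm ((1/2) *\<^sub>R (x + y)))\<^sup>2 = (norm (x + y))\<^sup>2 / 4" by (simp add: power_divide)
    then show ?thesis unfolding J_def norm_diff_sq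
      by (simp only: norm_add_sq) (simp add: g.scaleR g.add field_simps)
  qed
  have cauchy: "Cauchy X"
  proof (rule metric_CauchyI)
    fix e :: real assume e: "e > 0"
    obtain N where N: "1 / real (Suc N) < e\<^sup>2 / 4"
      using e reals_Archimedean[of "e\<^sup>2 / 4"] by (auto simp: inverse_eq_divide)
    have arith: "A < z" if "A = 2 * (p + q - 2 * r)" "p < m + u" "q < m + v" "m \<le> r" "u \<le> w" "v \<le> w" "w < z / 4"
      for A p q r u v w z :: real
      using that by argo
    have "dist (X i) (X j) < e" if "i \<ge> N" "j \<ge> N" for i j
    proof -
      have "1 / real (Suc i) \<le> 1 / real (Suc N)" "1 / real (Suc j) \<le> 1 / real (Suc N)"
        using that by (auto simp: field_simps)
      then have "(norm (X i - X j))\<^sup>2 < e\<^sup>2"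
        using arith[OF par X X mle _ _ N] by blast
      then show ?thesis using e by (simp add: dist_norm power_less_imp_less_base)
    qed
    then show "\<exists>M. \<forall>i\<ge>M. \<forall>j\<ge>M. dist (X i) (X j) < e" by blast
  qed
  then obtain y where y: "X \<longlonglongrightarrow> y" using Cauchy_convergent convergent_def by blast
  have "(\<lambda>n. J (X n)) \<longlonglongrightarrow> J y"
    unfolding J_def by (intro tendsto_intros y g.tendsto)
  moreover have "(\<lambda>n. J (X n)) \<longlonglongrightarrow> m"
  proof (rule tendsto_sandwich[of "\<lambda>_. m" _ _ "\<lambda>n. m + 1 / real (Suc n)"])
    show "(\<lambda>n. m + 1 / real (Suc n)) \<longlonglongrightarrow> m"
      using tendsto_add[OF tendsto_const[of m] LIMSEQ_inverse_real_of_nat] by (simp add: inverse_eq_divide)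
  qed (use mle X in \<open>auto intro!: always_eventually less_imp_le\<close>)
  ultimately have Jy: "J y = m" using LIMSEQ_unique by blast
  have re: "Re (g x) = Re (cinner x y)" for x
  proof -
    \<comment> \<open>First variation: \<open>d\<close> is half the derivative of \<open>J\<close>
      at the minimiser \<open>y\<close> in the direction \<open>x\<close>. The quadratic
      \<open>q\<close> is tested at \<open>- (d / s)\<close>, where the summand 1 in
      \<open>s\<close> keeps the quotient meaningful for \<open>x = 0\<close>.\<close>
    define d where "d = Re (cinner y x) - Re (g x)"
    have q: "0 \<le> t\<^sup>2 * (norm x)\<^sup>2 + 2 * t * d" for t
      using mle[of "y + t *\<^sub>R x"] Jy unfolding J_def d_def
      by (simp add: norm_add_sq g.add g.scaleR cinner_simps power_mult_distrib algebra_simps)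
    define s where "s = (norm x)\<^sup>2 + 1"
    have s: "s > 0" unfolding s_def by (simp add: add_nonneg_pos)
    have "0 \<le> (- (d / s))\<^sup>2 * (norm x)\<^sup>2 + 2 * (- (d / s)) * d" by (rule q)
    also have "\<dots> = - (d\<^sup>2 / s\<^sup>2) * (s + 1)"
    proof -
      have nx: "(norm x)\<^sup>2 = s - 1" by (simp add: s_def)
      show ?thesis unfolding nx using s by (simp add: field_simps power2_eq_square)
    qed
    finally have "d\<^sup>2 / s\<^sup>2 * (s + 1) \<le> 0" by simp
    then have "d = 0" using s by (auto simp: divide_le_0_iff mult_le_0_iff)
    then show ?thesis unfolding d_def by (subst cinner_commute) simp
  qed
  have "g x = cinner x y" for x
  proof (rule complex_eqI)
    show "Im (g x) = Im (cinner x y)"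
      using re[of "\<i> *\<^sub>C x"] by (simp add: hom cinner_simps)
  qed (rule re)
  then show ?thesis by blast
qed

lemma bopD: "a \<in> bop \<Longrightarrow> blinfun_apply a (c *\<^sub>C x) = c *\<^sub>C blinfun_apply a x"
  by (simp add: bop_def)

text \<open>Riesz is applied to each functional x -> <a x, y>. Testing the resulting identity at
  \<open>b y\<close> and cancelling one factor bounds \<open>b\<close> by the norm of
  \<open>a\<close>.\<close>

lemma adjoint_exists:
  assumes "a \<in> bop"
  shows "\<exists>b \<in> bop. \<forall>x y. cinner (blinfun_apply a x) y = cinner x (blinfun_apply b y)"
proof -
  have "\<exists>z. \<forall>x. cinner (blinfun_apply a x) y = cinner x z" for y
    by (rule riesz_representation)
      (auto intro!: bounded_linear_compose[OF bounded_bilinear.bounded_linear_left[OF bounded_bilinear_cinner]]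
        blinfun.bounded_linear_right simp: bopD[OF assms] cinner_simps)
  then obtain b where b: "\<And>x y. cinner (blinfun_apply a x) y = cinner x (b y)" by metis
  have add: "b (x + y) = b x + b y" for x y
    by (rule cinner_eqI) (simp add: b[symmetric] cinner_simps)
  have scC: "b (c *\<^sub>C x) = c *\<^sub>C b x" for c x
    by (rule cinner_eqI) (simp add: b[symmetric] cinner_simps)
  have sc: "b (r *\<^sub>R x) = r *\<^sub>R b x" for r x
    using scC[of "of_real r" x] by (simp add: scaleC_of_real)
  have bd: "norm (b y) \<le> norm y * norm a" for y
  proof (cases "b y = 0")
    case False
    have "complex_of_real ((norm (b y))\<^sup>2) = cinner (blinfun_apply a (b y)) y"
      by (simp add: b cinner_self)
    then have "(norm (b y))\<^sup>2 = cmod (cinner (blinfun_apply a (b y)) y)"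
      by (metis abs_of_nonneg norm_of_real zero_le_power2)
    also have "\<dots> \<le> norm (blinfun_apply a (b y)) * norm y" by (rule cinner_cauchy_schwarz)
    also have "\<dots> \<le> (norm a * norm (b y)) * norm y"
      by (intro mult_right_mono norm_blinfun) simp
    finally show ?thesis using False by (simp add: power2_eq_square mult.assoc mult_le_cancel_left mult.commute)
  qed simp
  have "bounded_linear b" by (rule bounded_linear_intro[of _ "norm a"]) (auto simp: add sc bd)
  then have ap: "blinfun_apply (Blinfun b) = b" by (rule bounded_linear_Blinfun_apply)
  show ?thesis by (rule bexI[of _ "Blinfun b"]) (auto simp: ap bop_def scC b)
qed

lemma adj_eqI:
  assumes "b \<in> bop" "\<And>x y. cinner (blinfun_apply a x) y = cinner x (blinfun_apply b y)"
  shows "adj a = b"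
  unfolding adj_def
proof (rule the_equality)
  fix c assume c: "c \<in> bop \<and> (\<forall>x y. cinner (blinfun_apply a x) y = cinner x (blinfun_apply c y))"
  show "c = b"
    by (rule blinfun_eqI, rule cinner_eqI) (metis assms(2) c)
qed (use assms in auto)

lemma cinner_adj:
  assumes "a \<in> bop"
  shows "adj a \<in> bop" "cinner (blinfun_apply a x) y = cinner x (blinfun_apply (adj a) y)"
  using adjoint_exists[OF assms] adj_eqI by auto

section \<open>Closure properties of the complex-linear operators\<close>

lemma bop_zero: "0 \<in> bop" by (simp add: bop_def)
lemma bop_id: "id_blinfun \<in> bop" by (simp add: bop_def)
lemma bop_add: "a \<in> bop \<Longrightarrow> b \<in> bop \<Longrightarrow> a + b \<in> bop"
  by (simp add: bop_def blinfun.add_left scaleC_add_right)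
lemma bop_diff: "a \<in> bop \<Longrightarrow> b \<in> bop \<Longrightarrow> a - b \<in> bop"
  by (simp add: bop_def blinfun.diff_left scaleC_diff_right)
lemma bop_scaleR: "a \<in> bop \<Longrightarrow> r *\<^sub>R a \<in> bop"
  by (simp add: bop_def blinfun.scaleR_left scaleC_scaleR_commute)
lemma bop_sum: "(\<And>i. i \<in> F \<Longrightarrow> f i \<in> bop) \<Longrightarrow> (\<Sum>i\<in>F. f i) \<in> bop"
  by (induction F rule: infinite_finite_induct) (auto intro: bop_add bop_zero)
lemma bop_LIMSEQ:
  assumes "\<And>n. f n \<in> bop" "f \<longlonglongrightarrow> a"
  shows "a \<in> bop"
  unfolding bop_def
proof (intro CollectI allI)
  fix c x
  have ev: "(\<lambda>n. blinfun_apply (f n) y) \<longlonglongrightarrow> blinfun_apply a y" for y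
    by (intro blinfun.tendsto assms tendsto_const)
  have "(\<lambda>n. c *\<^sub>C blinfun_apply (f n) x) \<longlonglongrightarrow> c *\<^sub>C blinfun_apply a x"
    by (intro tendsto_scaleC ev tendsto_const)
  then have "(\<lambda>n. blinfun_apply (f n) (c *\<^sub>C x)) \<longlonglongrightarrow> c *\<^sub>C blinfun_apply a x"
    by (simp add: bopD[OF assms(1)])
  then show "blinfun_apply a (c *\<^sub>C x) = c *\<^sub>C blinfun_apply a x"
    using ev LIMSEQ_unique by blast
qed

subsection \<open>Orthonormal families\<close>

definition orthonormal_on :: "'i set \<Rightarrow> ('i \<Rightarrow> 'a::complex_hilbert_space) \<Rightarrow> bool" where
  "orthonormal_on I e \<longleftrightarrow> (\<forall>i\<in>I. \<forall>j\<in>I. cinner (e i) (e j) = (if i = j then 1 else 0))"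

lemma orthonormal_onD:
  "orthonormal_on I e \<Longrightarrow> i \<in> I \<Longrightarrow> j \<in> I \<Longrightarrow> cinner (e i) (e j) = (if i = j then 1 else 0)"
  by (simp add: orthonormal_on_def)

lemma orthonormal_on_subset: "orthonormal_on I e \<Longrightarrow> J \<subseteq> I \<Longrightarrow> orthonormal_on J e"
  unfolding orthonormal_on_def by blast

lemma norm_eq_1_iff_cinner: "norm x = 1 \<longleftrightarrow> cinner x x = 1"
proof
  assume "cinner x x = 1"
  then have "(norm x)\<^sup>2 = 1" by (simp add: norm_sq_cinner)
  then show "norm x = 1" by (simp add: power2_eq_1_iff) (use norm_ge_zero[of x] in linarith)
qed (simp add: cinner_self)

lemma orthonormal_on_norm: "orthonormal_on I e \<Longrightarrow> i \<in> I \<Longrightarrow> norm (e i) = 1"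
  by (simp add: norm_eq_1_iff_cinner orthonormal_onD)

lemma cinner_orthonormal_sum:
  assumes "orthonormal_on F e" "finite F" "j \<in> F"
  shows "cinner (\<Sum>i\<in>F. c i *\<^sub>C e i) (e j) = c j"
proof -
  have "cinner (\<Sum>i\<in>F. c i *\<^sub>C e i) (e j) = (\<Sum>i\<in>F. if i = j then c i else 0)"
    unfolding cinner_sum_left using assms
    by (intro sum.cong) (auto simp: cinner_scaleC_left orthonormal_onD)
  then show ?thesis using assms by simp
qed

lemma norm_sq_orthonormal_sum:
  assumes "orthonormal_on F e" "finite F"
  shows "(norm (\<Sum>i\<in>F. c i *\<^sub>C e i))\<^sup>2 = (\<Sum>i\<in>F. (cmod (c i))\<^sup>2)"
proof -
  have "complex_of_real ((norm (\<Sum>i\<in>F. c i *\<^sub>C e i))\<^sup>2) = (\<Sum>j\<in>F. cnj (c j) * c j)"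
    unfolding cinner_self[symmetric] cinner_sum_right using assms
    by (intro sum.cong) (auto simp: cinner_scaleC_right cinner_orthonormal_sum)
  also have "\<dots> = complex_of_real (\<Sum>i\<in>F. (cmod (c i))\<^sup>2)"
    unfolding of_real_sum by (intro sum.cong) (simp_all only: complex_norm_square mult.commute)
  finally show ?thesis by (simp only: of_real_eq_iff)
qed

lemma orthonormal_residual:
  fixes x :: "'a::complex_hilbert_space"
  assumes "orthonormal_on F e" "finite F"
  defines "y \<equiv> x - (\<Sum>i\<in>F. cinner x (e i) *\<^sub>C e i)"
  shows "j \<in> F \<Longrightarrow> cinner y (e j) = 0"
    and "(norm x)\<^sup>2 = (norm y)\<^sup>2 + (\<Sum>i\<in>F. (cmod (cinner x (e i)))\<^sup>2)"
proof -
  show orth: "cinner y (e j) = 0" if "j \<in> F" for j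
    using cinner_orthonormal_sum[OF assms(1,2) that, of "\<lambda>i. cinner x (e i)"]
    by (simp add: y_def cinner_simps)
  have "cinner y (\<Sum>i\<in>F. cinner x (e i) *\<^sub>C e i) = 0"
    unfolding cinner_sum_right by (intro sum.neutral) (simp add: cinner_simps orth)
  moreover have "x = y + (\<Sum>i\<in>F. cinner x (e i) *\<^sub>C e i)" by (simp add: y_def)
  ultimately have "(norm x)\<^sup>2 = (norm y)\<^sup>2 + (norm (\<Sum>i\<in>F. cinner x (e i) *\<^sub>C e i))\<^sup>2"
    using norm_add_sq[of y "\<Sum>i\<in>F. cinner x (e i) *\<^sub>C e i"] by simp
  then show "(norm x)\<^sup>2 = (norm y)\<^sup>2 + (\<Sum>i\<in>F. (cmod (cinner x (e i)))\<^sup>2)"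
    by (simp only: norm_sq_orthonormal_sum[OF assms(1,2)])
qed

lemma norm_orthonormal_residual:
  assumes "orthonormal_on F e" "finite F"
  shows "norm (x - (\<Sum>i\<in>F. cinner x (e i) *\<^sub>C e i)) \<le> norm x"
  by (rule power2_le_imp_le) (simp_all add: orthonormal_residual(2)[OF assms, of x] sum_nonneg)

lemma bessel:
  assumes "orthonormal_on F e" "finite F"
  shows "(\<Sum>i\<in>F. (cmod (cinner x (e i)))\<^sup>2) \<le> (norm x)\<^sup>2"
  by (simp add: orthonormal_residual(2)[OF assms, of x])

text \<open>Gram-Schmidt without bases: \<open>E\<close> only has to reproduce each vector of the
  span by its Fourier sum, so a generator that depends on the earlier ones merely has zero residual
  and adds nothing.\<close>

lemma orthonormal_cover:
  fixes B :: "'a::complex_hilbert_space set"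
  assumes "finite B"
  shows "\<exists>E. finite E \<and> orthonormal_on E (\<lambda>u. u) \<and> (\<forall>b \<in> cvec.span B. (\<Sum>u\<in>E. cinner b u *\<^sub>C u) = b)"
proof -
  have "\<exists>E. finite E \<and> orthonormal_on E (\<lambda>u. u) \<and> (\<forall>b \<in> B. (\<Sum>u\<in>E. cinner b u *\<^sub>C u) = b)"
    using assms
  proof (induction B)
    case (insert b B)
    then obtain E where E: "finite E" "orthonormal_on E (\<lambda>u. u)" "\<And>b. b \<in> B \<Longrightarrow> (\<Sum>u\<in>E. cinner b u *\<^sub>C u) = b"
      by blast
    define y where "y = b - (\<Sum>u\<in>E. cinner b u *\<^sub>C u)"
    have oy: "cinner y u = 0" if "u \<in> E" for u
      using orthonormal_residual(1)[OF E(2,1), of u b] that by (simp add: y_def)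
    show ?case
    proof (cases "y = 0")
      case True
      then have "(\<Sum>u\<in>E. cinner b u *\<^sub>C u) = b" unfolding y_def by (metis eq_iff_diff_eq_0)
      then show ?thesis using E by blast
    next
      case False
      define v where "v = (1 / norm y) *\<^sub>R y"
      have vv: "cinner v v = 1" using False
        by (simp add: v_def cinner_simps cinner_self power2_eq_square)
      have uv: "cinner v u = 0" "cinner u v = 0" if "u \<in> E" for u
        using oy[OF that] cinner_commute[of u y] by (auto simp: v_def cinner_simps)
      have vE: "v \<notin> E" using uv vv by force
      have bv: "cinner b v *\<^sub>C v = y"
      proof -
        have "cinner b v = cinner y v"
          unfolding y_def by (simp add: cinner_simps cinner_sum_left uv)
        also have "\<dots> = of_real (norm y)"
          using False by (simp add: v_def cinner_simps cinner_self power2_eq_square)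
        finally show ?thesis using False by (simp add: v_def scaleC_of_real)
      qed
      have cv: "cinner c v = 0" if "c \<in> B" for c
        by (subst E(3)[OF that, symmetric]) (simp add: cinner_simps cinner_sum_left uv)
      show ?thesis
      proof (intro exI[of _ "insert v E"] conjI ballI)
        show "orthonormal_on (insert v E) (\<lambda>u. u)"
          using E(2) vv uv vE by (auto simp: orthonormal_on_def)
        fix c assume c: "c \<in> insert b B"
        show "(\<Sum>u\<in>insert v E. cinner c u *\<^sub>C u) = c"
        proof (cases "c = b")
          case True
          then show ?thesis using E vE bv by (simp add: y_def)
        next
          case False
          then show ?thesis using E vE cv c by auto
        qed
      qed (use E in simp)
    qed
  qed (auto simp: orthonormal_on_def)
  then obtain E where E: "finite E" "orthonormal_on E (\<lambda>u. u)" "\<And>b. b \<in> B \<Longrightarrow> (\<Sum>u\<in>E. cinner b u *\<^sub>C u) = b"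
    by blast
  \<comment> \<open>The reproduced vectors form a subspace, so it was enough to treat the
    generators.\<close>
  have "cvec.subspace {b. (\<Sum>u\<in>E. cinner b u *\<^sub>C u) = b}"
  proof (rule cvec.subspaceI; unfold mem_Collect_eq)
    fix x y c
    assume x: "(\<Sum>u\<in>E. cinner x u *\<^sub>C u) = x"
    show "(\<Sum>u\<in>E. cinner (c *\<^sub>C x) u *\<^sub>C u) = c *\<^sub>C x"
      unfolding cinner_scaleC_left scaleC_scaleC[symmetric] scaleC_sum_right[symmetric] x ..
    assume y: "(\<Sum>u\<in>E. cinner y u *\<^sub>C u) = y"
    show "(\<Sum>u\<in>E. cinner (x + y) u *\<^sub>C u) = x + y"
      unfolding cinner_add_left scaleC_add_left sum.distrib x y ..
  qed simp
  moreover have "B \<subseteq> {b. (\<Sum>u\<in>E. cinner b u *\<^sub>C u) = b}"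
    by (intro subsetI CollectI E(3))
  ultimately have "cvec.span B \<subseteq> {b. (\<Sum>u\<in>E. cinner b u *\<^sub>C u) = b}"
    by (rule cvec.span_minimal[rotated])
  then have "\<forall>b\<in>cvec.span B. (\<Sum>u\<in>E. cinner b u *\<^sub>C u) = b"
    by (simp only: subset_iff mem_Collect_eq Ball_def)
  then show ?thesis by (intro exI[of _ E] conjI E)
qed

text \<open>This is where infinite dimension enters: some vector lies outside the span of the
  orthonormal cover, and its normalised residual is the witness.\<close>

lemma unit_vector_orthogonal:
  fixes B :: "'a::complex_hilbert_space set"
  assumes "infinite_dimensional TYPE('a)" "finite B"
  shows "\<exists>v. norm v = 1 \<and> (\<forall>b\<in>B. cinner v b = 0)"
proof -
  obtain E where E: "finite E" "orthonormal_on E (\<lambda>u. u)" "\<And>b. b \<in> cvec.span B \<Longrightarrow> (\<Sum>u\<in>E. cinner b u *\<^sub>C u) = b"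
    using orthonormal_cover[OF assms(2)] by blast
  obtain x where x: "x \<notin> cvec.span E"
    using assms(1) E(1) unfolding infinite_dimensional_def by auto
  define y where "y = x - (\<Sum>u\<in>E. cinner x u *\<^sub>C u)"
  have "(\<Sum>u\<in>E. cinner x u *\<^sub>C u) \<in> cvec.span E"
    by (intro cvec.span_sum cvec.span_scale cvec.span_base)
  then have y0: "y \<noteq> 0" using x by (auto simp: y_def)
  have oy: "cinner y u = 0" if "u \<in> E" for u
    using orthonormal_residual(1)[OF E(2,1), of u x] that by (simp add: y_def)
  have "cinner y b = 0" if "b \<in> B" for b
    by (subst E(3)[OF cvec.span_base[OF that], symmetric]) (simp add: cinner_sum_right cinner_simps oy)
  then show ?thesis
    using y0 by (intro exI[of _ "(1 / norm y) *\<^sub>R y"]) (auto simp: cinner_simps)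
qed

subsection \<open>Diagonal operators\<close>

text \<open>A projection only for unit \<open>v\<close>. Other lengths are used as well: the
  reflection in \<open>unitarily_invariant_swap\<close> is built from vectors of norm sqrt
  2.\<close>

definition proj :: "'a::complex_hilbert_space \<Rightarrow> 'a \<Rightarrow>\<^sub>L 'a" where
  "proj v = Blinfun (\<lambda>x. cinner x v *\<^sub>C v)"

lemma proj_apply: "blinfun_apply (proj v) x = cinner x v *\<^sub>C v"
proof -
  have "bounded_linear (\<lambda>x. cinner x v *\<^sub>C v)"
    using bounded_linear_compose[OF bounded_bilinear.bounded_linear_left[OF bounded_bilinear_scaleC]
        bounded_bilinear.bounded_linear_left[OF bounded_bilinear_cinner]] .
  then show ?thesis by (simp add: proj_def bounded_linear_Blinfun_apply)
qed

lemma bop_proj: "proj v \<in> bop"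
  by (simp add: bop_def proj_apply cinner_simps scaleC_scaleC)

lemma norm_sum_proj_le:
  assumes F: "orthonormal_on F e" "finite F" and "0 \<le> M" "\<And>i. i \<in> F \<Longrightarrow> \<bar>l i\<bar> \<le> M"
  shows "norm (\<Sum>i\<in>F. l i *\<^sub>R proj (e i)) \<le> M"
proof (rule norm_blinfun_bound)
  fix x
  have "blinfun_apply (\<Sum>i\<in>F. l i *\<^sub>R proj (e i)) x = (\<Sum>i\<in>F. (of_real (l i) * cinner x (e i)) *\<^sub>C e i)"
    by (simp add: blinfun.sum_left blinfun.scaleR_left proj_apply scaleC_of_real[symmetric])
  then have "(norm (blinfun_apply (\<Sum>i\<in>F. l i *\<^sub>R proj (e i)) x))\<^sup>2
      = (\<Sum>i\<in>F. (l i)\<^sup>2 * (cmod (cinner x (e i)))\<^sup>2)"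
    by (simp add: norm_sq_orthonormal_sum[OF F] norm_mult power_mult_distrib)
  also have "\<dots> \<le> (\<Sum>i\<in>F. M\<^sup>2 * (cmod (cinner x (e i)))\<^sup>2)"
    using assms by (intro sum_mono mult_right_mono) (auto simp: abs_le_square_iff[symmetric])
  also have "\<dots> \<le> M\<^sup>2 * (norm x)\<^sup>2"
    unfolding sum_distrib_left[symmetric] by (intro mult_left_mono bessel F) simp
  finally have "(norm (blinfun_apply (\<Sum>i\<in>F. l i *\<^sub>R proj (e i)) x))\<^sup>2 \<le> (M * norm x)\<^sup>2"
    by (simp only: power_mult_distrib)
  then show "norm (blinfun_apply (\<Sum>i\<in>F. l i *\<^sub>R proj (e i)) x) \<le> M * norm x"
    by (rule power2_le_imp_le) (simp add: \<open>0 \<le> M\<close>)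
qed fact

text \<open>The family \<open>e\<close> need not span a dense subspace; vectors orthogonal to all of
  it are mapped to 0. In the facts about it \<open>l\<close> tends to 0, which makes the series
  converge in operator norm.\<close>

definition diag :: "(nat \<Rightarrow> 'a::complex_hilbert_space) \<Rightarrow> (nat \<Rightarrow> real) \<Rightarrow> 'a \<Rightarrow>\<^sub>L 'a" where
  "diag e l = (\<Sum>n. l n *\<^sub>R proj (e n))"

abbreviation "orthonormal \<equiv> orthonormal_on (UNIV :: nat set)"

text \<open>Convergence is in general not absolute. A block of the series has norm at most the
  largest absolute value of an entry in it, so the Cauchy criterion holds as soon as the entries
  tend to 0.\<close>

lemma diag_sums:
  assumes e: "orthonormal e" and l: "l \<longlonglongrightarrow> 0"
  shows "(\<lambda>n. l n *\<^sub>R proj (e n)) sums diag e l"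
  unfolding diag_def
proof (rule summable_sums, unfold summable_Cauchy, intro allI impI)
  fix r :: real assume r: "0 < r"
  then obtain N where N: "\<And>n. n \<ge> N \<Longrightarrow> \<bar>l n\<bar> < r / 2"
    using LIMSEQ_D[OF l, of "r / 2"] by auto
  show "\<exists>N. \<forall>m\<ge>N. \<forall>n. norm (\<Sum>n = m..<n. l n *\<^sub>R proj (e n)) < r"
  proof (intro exI allI impI)
    fix m n assume "m \<ge> N"
    then have "norm (\<Sum>n = m..<n. l n *\<^sub>R proj (e n)) \<le> r / 2"
      using r N by (intro norm_sum_proj_le orthonormal_on_subset[OF e]) (auto intro: less_imp_le)
    then show "norm (\<Sum>n = m..<n. l n *\<^sub>R proj (e n)) < r" using r by simp
  qed
qed

lemma diag_eqI: "(\<lambda>n. l n *\<^sub>R proj (e n)) sums a \<Longrightarrow> diag e l = a"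
  unfolding diag_def by (rule sums_unique[symmetric])

lemma norm_diag_le:
  assumes e: "orthonormal e" and l: "l \<longlonglongrightarrow> 0" and M: "\<And>n. \<bar>l n\<bar> \<le> M"
  shows "norm (diag e l) \<le> M"
proof (rule LIMSEQ_le_const2)
  show "(\<lambda>n. norm (\<Sum>i<n. l i *\<^sub>R proj (e i))) \<longlonglongrightarrow> norm (diag e l)"
    using diag_sums[OF e l] by (intro tendsto_norm) (simp add: sums_def)
  have "0 \<le> M" using M[of 0] by linarith
  then show "\<exists>N. \<forall>n\<ge>N. norm (\<Sum>i<n. l i *\<^sub>R proj (e i)) \<le> M"
    using M by (intro exI[of _ 0] allI impI norm_sum_proj_le orthonormal_on_subset[OF e]) auto
qed

lemma diag_finite:
  assumes "\<And>n. n \<ge> N \<Longrightarrow> l n = 0"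
  shows "diag e l = (\<Sum>n<N. l n *\<^sub>R proj (e n))"
  by (intro diag_eqI sums_finite) (use assms in auto)

lemma diag_zero [simp]: "diag e (\<lambda>_. 0) = 0"
  by (simp add: diag_def)

lemma diag_apply_sums:
  assumes "orthonormal e" "l \<longlonglongrightarrow> 0"
  shows "(\<lambda>n. l n *\<^sub>R cinner x (e n) *\<^sub>C e n) sums blinfun_apply (diag e l) x"
  using bounded_linear.sums[OF blinfun.bounded_linear_left diag_sums[OF assms], of x]
  by (simp add: blinfun.scaleR_left proj_apply)

lemma bop_diag:
  assumes "orthonormal e" "l \<longlonglongrightarrow> 0"
  shows "diag e l \<in> bop"
  using diag_sums[OF assms] unfolding sums_def
  by (rule bop_LIMSEQ[rotated]) (intro bop_sum bop_scaleR bop_proj)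

lemma diag_add:
  assumes "orthonormal e" "l \<longlonglongrightarrow> 0" "m \<longlonglongrightarrow> 0"
  shows "diag e (\<lambda>n. l n + m n) = diag e l + diag e m"
  using sums_add[OF diag_sums[OF assms(1,2)] diag_sums[OF assms(1,3)]]
  by (intro diag_eqI) (simp add: scaleR_add_left)

lemma diag_scaleR:
  assumes "orthonormal e" "l \<longlonglongrightarrow> 0"
  shows "diag e (\<lambda>n. c * l n) = c *\<^sub>R diag e l"
  using sums_scaleR_right[OF diag_sums[OF assms], of c] by (intro diag_eqI) simp

lemma diag_diff:
  assumes "orthonormal e" "l \<longlonglongrightarrow> 0" "m \<longlonglongrightarrow> 0"
  shows "diag e (\<lambda>n. l n - m n) = diag e l - diag e m"
  using sums_diff[OF diag_sums[OF assms(1,2)] diag_sums[OF assms(1,3)]]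
  by (intro diag_eqI) (simp add: scaleR_diff_left)

lemma diag_eigenvector:
  assumes e: "orthonormal e" and l: "l \<longlonglongrightarrow> 0"
  shows "blinfun_apply (diag e l) (e k) = l k *\<^sub>R e k"
proof -
  have "(\<lambda>n. l n *\<^sub>R cinner (e k) (e n) *\<^sub>C e n) = (\<lambda>n. if n = k then l n *\<^sub>R e n else 0)"
    using orthonormal_onD[OF e] by (auto simp: scaleC_one)
  then show ?thesis
    using diag_apply_sums[OF e l, of "e k"] sums_unique2[OF _ sums_single[of k "\<lambda>n. l n *\<^sub>R e n"]] by simp
qed

lemma cinner_diag_sums:
  assumes "orthonormal e" "l \<longlonglongrightarrow> 0"
  shows "(\<lambda>n. of_real (l n) * (cinner x (e n) * cinner (e n) y)) sums cinner (blinfun_apply (diag e l) x) y"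
  using bounded_linear.sums[OF bounded_bilinear.bounded_linear_left[OF bounded_bilinear_cinner]
      diag_apply_sums[OF assms], of x y]
  by (simp add: cinner_simps)

lemma cinner_diag_self_sums:
  assumes "orthonormal e" "l \<longlonglongrightarrow> 0"
  shows "(\<lambda>n. l n * (cmod (cinner x (e n)))\<^sup>2) sums Re (cinner (blinfun_apply (diag e l) x) x)"
    and "Im (cinner (blinfun_apply (diag e l) x) x) = 0"
proof -
  have "of_real (l n) * (cinner x (e n) * cinner (e n) x) = of_real (l n * (cmod (cinner x (e n)))\<^sup>2)" for n
    by (simp only: of_real_mult complex_norm_square cnj_cinner)
  then have s: "(\<lambda>n. complex_of_real (l n * (cmod (cinner x (e n)))\<^sup>2)) sums cinner (blinfun_apply (diag e l) x) x"
    using cinner_diag_sums[OF assms, of x x] by (simp only:)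
  show "(\<lambda>n. l n * (cmod (cinner x (e n)))\<^sup>2) sums Re (cinner (blinfun_apply (diag e l) x) x)"
    using sums_Re[OF s] by simp
  show "Im (cinner (blinfun_apply (diag e l) x) x) = 0"
    using sums_unique2[OF sums_Im[OF s], of 0] by simp
qed

lemma positive_diag:
  assumes "orthonormal e" "l \<longlonglongrightarrow> 0" "\<And>n. 0 \<le> l n"
  shows "positive (diag e l)"
proof -
  have "0 \<le> Re (cinner (blinfun_apply (diag e l) x) x)" for x
    by (rule sums_le[OF _ sums_zero cinner_diag_self_sums(1)[OF assms(1,2)]]) (simp add: assms(3))
  then show ?thesis
    using cinner_diag_self_sums(2)[OF assms(1,2)] bop_diag[OF assms(1,2)]
    by (auto simp: positive_def complex_nonneg_Reals_iff)
qed

lemma compose_diag: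
  assumes e: "orthonormal e" and l: "l \<longlonglongrightarrow> 0" and m: "m \<longlonglongrightarrow> 0"
  shows "diag e m o\<^sub>L diag e l = diag e (\<lambda>n. m n * l n)"
proof -
  have p: "diag e m o\<^sub>L proj (e n) = m n *\<^sub>R proj (e n)" for n
    by (rule blinfun_eqI)
      (simp add: proj_apply blinfun.scaleR_left diag_eigenvector[OF e m] bopD[OF bop_diag[OF e m]] scaleC_scaleR_commute)
  then show ?thesis
    using bounded_linear.sums[OF bounded_bilinear.bounded_linear_right[OF bounded_bilinear_blinfun_compose]
        diag_sums[OF e l], of "diag e m"]
    by (intro diag_eqI[symmetric]) (simp add: bounded_bilinear.scaleR_right[OF bounded_bilinear_blinfun_compose] mult.commute p)
qed

lemma orthonormal_unitary:
  assumes "orthonormal_on I e" "unitary u"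
  shows "orthonormal_on I (\<lambda>n. blinfun_apply u (e n))"
proof -
  have "cinner (blinfun_apply u x) (blinfun_apply u y) = cinner x y" for x y
    using assms(2) cinner_adj(2)[of u x "blinfun_apply u y"] unfolding unitary_def
    by (metis blinfun_apply_blinfun_compose id_blinfun.rep_eq id_apply)
  then show ?thesis using assms(1) by (simp add: orthonormal_on_def)
qed

lemma bounded_linear_conjugate: "bounded_linear (\<lambda>x. u o\<^sub>L x o\<^sub>L v)"
  using bounded_linear_compose[OF bounded_bilinear.bounded_linear_left[OF bounded_bilinear_blinfun_compose]
      bounded_bilinear.bounded_linear_right[OF bounded_bilinear_blinfun_compose]] .

lemma unitary_conjugate_proj:
  assumes "unitary u"
  shows "u o\<^sub>L proj v o\<^sub>L adj u = proj (blinfun_apply u v)"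
proof (rule blinfun_eqI)
  have ub: "u \<in> bop" using assms by (simp add: unitary_def)
  fix x
  show "blinfun_apply (u o\<^sub>L proj v o\<^sub>L adj u) x = blinfun_apply (proj (blinfun_apply u v)) x"
    by (metis (no_types, lifting) blinfun_apply_blinfun_compose proj_apply bopD[OF ub] cinner_adj(2)[OF ub] cinner_commute)
qed

lemma unitary_conjugate_diag:
  assumes e: "orthonormal e" and l: "l \<longlonglongrightarrow> 0" and u: "unitary u"
  shows "u o\<^sub>L diag e l o\<^sub>L adj u = diag (\<lambda>n. blinfun_apply u (e n)) l"
  using bounded_linear.sums[OF bounded_linear_conjugate diag_sums[OF e l], of u "adj u"]
  by (intro diag_eqI[symmetric])
    (simp add: linear_cmul[OF bounded_linear.linear[OF bounded_linear_conjugate]] unitary_conjugate_proj[OF u])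

section \<open>Rearrangement of diagonal operators\<close>

lemma LIMSEQ_inj:
  fixes s :: "nat \<Rightarrow> nat"
  assumes "inj s" "l \<longlonglongrightarrow> L"
  shows "(\<lambda>n. l (s n)) \<longlonglongrightarrow> L"
proof -
  have "eventually (\<lambda>n. Z \<le> s n) cofinite" for Z
  proof -
    have "finite (s -` {..<Z})" by (rule finite_vimageI) (simp_all add: assms(1))
    moreover have "{n. \<not> Z \<le> s n} = s -` {..<Z}" by auto
    ultimately show ?thesis by (simp only: eventually_cofinite)
  qed
  then have "filterlim s sequentially sequentially"
    by (simp only: filterlim_at_top cofinite_eq_sequentially) simp
  from filterlim_compose[OF assms(2) this] show ?thesis .
qed

lemma diag_finite_set:
  assumes "finite A"
  shows "diag e (\<lambda>k. if k \<in> A then m k else 0) = (\<Sum>k\<in>A. m k *\<^sub>R proj (e k))"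
proof (rule diag_eqI)
  have "(\<lambda>k. if k \<in> A then m k *\<^sub>R proj (e k) else 0) sums (\<Sum>k\<in>A. m k *\<^sub>R proj (e k))"
    by (rule sums_If_finite_set[OF assms])
  then show "(\<lambda>k. (if k \<in> A then m k else 0) *\<^sub>R proj (e k)) sums (\<Sum>k\<in>A. m k *\<^sub>R proj (e k))"
    by (rule back_subst[of "\<lambda>f. f sums _"]) auto
qed

lemma diag_reindex:
  fixes s :: "nat \<Rightarrow> nat"
  assumes e: "orthonormal e" and m: "m \<longlonglongrightarrow> 0" and s: "inj s"
    and out: "\<And>k. k \<notin> range s \<Longrightarrow> m k = 0"
  shows "diag (\<lambda>i. e (s i)) (\<lambda>i. m (s i)) = diag e m"
proof (rule diag_eqI, unfold sums_def, rule LIMSEQ_I)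
  fix r :: real assume r: "0 < r"
  then obtain N where N: "\<And>k. k \<ge> N \<Longrightarrow> \<bar>m k\<bar> < r / 2"
    using LIMSEQ_D[OF m, of "r / 2"] by auto
  have "{k. k < N \<and> m k \<noteq> 0} \<subseteq> range s" using out by blast
  then obtain C where C: "finite C" "{k. k < N \<and> m k \<noteq> 0} = s ` C"
    using finite_subset_image[of "{k. k < N \<and> m k \<noteq> 0}" s UNIV] by auto
  obtain N0 where N0: "C \<subseteq> {..<N0}" using C(1) finite_nat_iff_bounded by blast
  have "norm ((\<Sum>i<n. m (s i) *\<^sub>R proj (e (s i))) - diag e m) < r" if n: "n \<ge> N0" for n
  proof -
    let ?A = "s ` {..<n}"
    have lim: "(\<lambda>k. if k \<in> ?A then m k else 0) \<longlonglongrightarrow> 0"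
      by (rule tendsto_eventually, rule eventually_sequentiallyI[of "Suc (Max ?A)"])
        (auto simp: Suc_le_eq dest!: order.strict_trans1[OF Max_ge, rotated 2])
    have "(\<Sum>i<n. m (s i) *\<^sub>R proj (e (s i))) = (\<Sum>k\<in>?A. m k *\<^sub>R proj (e k))"
      by (subst sum.reindex) (auto intro: inj_on_subset[OF s])
    also have "\<dots> = diag e (\<lambda>k. if k \<in> ?A then m k else 0)"
      by (rule diag_finite_set[symmetric]) simp
    finally have "(\<Sum>i<n. m (s i) *\<^sub>R proj (e (s i))) - diag e m
        = diag e (\<lambda>k. (if k \<in> ?A then m k else 0) - m k)"
      by (simp only: diag_diff[OF e lim m])
    moreover have "norm \<dots> \<le> r / 2"
    proof (rule norm_diag_le[OF e])
      show "(\<lambda>k. (if k \<in> ?A then m k else 0) - m k) \<longlonglongrightarrow> 0"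
        using tendsto_diff[OF lim m] by simp
      fix k
      show "\<bar>(if k \<in> ?A then m k else 0) - m k\<bar> \<le> r / 2"
      proof (cases "k \<in> ?A")
        case False
        then have "k \<notin> s ` C" using N0 n by auto
        then have "k \<notin> {k. k < N \<and> m k \<noteq> 0}" by (simp only: C(2) not_False_eq_True)
        then have "m k = 0 \<or> k \<ge> N" by auto
        then show ?thesis using False N[of k] r by auto
      qed (use r in simp)
    qed
    ultimately show ?thesis using r by simp
  qed
  then show "\<exists>no. \<forall>n\<ge>no. norm ((\<Sum>i<n. m (s i) *\<^sub>R proj (e (s i))) - diag e m) < r" by blast
qed

subsection \<open>Compactness\<close>

lemma compact_opI:
  assumes "a \<in> bop" "compact C" "\<And>x. norm x \<le> 1 \<Longrightarrow> blinfun_apply a x \<in> C"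
  shows "compact_op a"
proof -
  have "closure (blinfun_apply a ` cball 0 1) \<subseteq> C"
    by (rule closure_minimal) (use assms compact_imp_closed in auto)
  then have "closure (blinfun_apply a ` cball 0 1) = C \<inter> closure (blinfun_apply a ` cball 0 1)" by blast
  then show ?thesis using assms(1,2) compact_Int_closed[OF assms(2) closed_closure]
    unfolding compact_op_def by metis
qed

text \<open>The coefficients range over a product of closed discs. One such compact set catches the
  image of the unit ball for partial sums of diagonal operators and for operators of finite
  rank.\<close>

lemma compact_combinations:
  fixes e :: "'i \<Rightarrow> 'a::complex_hilbert_space"
  assumes "finite F"
  shows "\<exists>C. compact C \<and> (\<forall>c. (\<forall>i\<in>F. cmod (c i) \<le> M i) \<longrightarrow> (\<Sum>i\<in>F. c i *\<^sub>C e i) \<in> C)"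
  using assms
proof (induction F)
  case empty
  show ?case by (rule exI[of _ "{0}"]) simp
next
  case (insert j F)
  then obtain C where C: "compact C" "\<And>c. (\<forall>i\<in>F. cmod (c i) \<le> M i) \<Longrightarrow> (\<Sum>i\<in>F. c i *\<^sub>C e i) \<in> C" by blast
  have "continuous_on (cball 0 (M j)) (\<lambda>z. z *\<^sub>C e j)"
    by (intro linear_continuous_on bounded_bilinear.bounded_linear_left[OF bounded_bilinear_scaleC])
  then have "compact ((\<lambda>z. z *\<^sub>C e j) ` cball 0 (M j))" by (intro compact_continuous_image compact_cball)
  then have "compact {x + y |x y. x \<in> (\<lambda>z. z *\<^sub>C e j) ` cball 0 (M j) \<and> y \<in> C}"
    using C(1) by (rule compact_sums)
  moreover have "(\<Sum>i\<in>insert j F. c i *\<^sub>C e i) \<in> {x + y |x y. x \<in> (\<lambda>z. z *\<^sub>C e j) ` cball 0 (M j) \<and> y \<in> C}"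
    if "\<forall>i\<in>insert j F. cmod (c i) \<le> M i" for c
  proof -
    have "(\<Sum>i\<in>insert j F. c i *\<^sub>C e i) = c j *\<^sub>C e j + (\<Sum>i\<in>F. c i *\<^sub>C e i)"
      using insert(1,2) by simp
    moreover have "c j *\<^sub>C e j \<in> (\<lambda>z. z *\<^sub>C e j) ` cball 0 (M j)" using that by auto
    moreover have "(\<Sum>i\<in>F. c i *\<^sub>C e i) \<in> C" using that by (intro C(2)) auto
    ultimately show ?thesis by blast
  qed
  ultimately show ?case by blast
qed

lemma compact_op_LIMSEQ:
  assumes f: "\<And>n. compact_op (f n)" and lim: "f \<longlonglongrightarrow> a"
  shows "compact_op a"
proof -
  let ?S = "blinfun_apply a ` cball 0 1"
  have "\<exists>k. finite k \<and> closure ?S \<subseteq> (\<Union>x\<in>k. ball x r)" if r: "r > 0" for r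
  proof -
    obtain n where n: "norm (f n - a) < r / 3"
      using LIMSEQ_D[OF lim, of "r / 3"] r by auto
    obtain k where k: "finite k" "closure (blinfun_apply (f n) ` cball 0 1) \<subseteq> (\<Union>x\<in>k. ball x (r / 3))"
      using f[of n] r unfolding compact_op_def compact_eq_totally_bounded
      by (meson divide_pos_pos zero_less_numeral)
    \<comment> \<open>Closed balls of radius 2r/3 are used because their finite union is closed and
      so also covers the closure of the image.\<close>
    have "?S \<subseteq> (\<Union>x\<in>k. cball x (2 * r / 3))"
    proof
      fix y assume "y \<in> ?S"
      then obtain x where x: "norm x \<le> 1" "y = blinfun_apply a x" by auto
      then have "blinfun_apply (f n) x \<in> closure (blinfun_apply (f n) ` cball 0 1)"
        by (intro closure_subset[THEN subsetD] imageI) auto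
      then obtain z where z: "z \<in> k" "dist z (blinfun_apply (f n) x) < r / 3" using k(2) by auto
      have "dist (blinfun_apply (f n) x) y = norm (blinfun_apply (f n - a) x)"
        by (simp add: x(2) dist_norm blinfun.diff_left)
      also have "\<dots> \<le> norm (f n - a) * norm x" by (rule norm_blinfun)
      also have "\<dots> \<le> norm (f n - a)" using x(1) by (simp add: mult_left_le)
      finally have "dist z y \<le> 2 * r / 3"
        using dist_triangle[of z y "blinfun_apply (f n) x"] z(2) n by simp
      then show "y \<in> (\<Union>x\<in>k. cball x (2 * r / 3))" using z(1) by auto
    qed
    then have "closure ?S \<subseteq> (\<Union>x\<in>k. cball x (2 * r / 3))"
      using k(1) by (intro closure_minimal) auto
    also have "\<dots> \<subseteq> (\<Union>x\<in>k. ball x r)" using r by fastforce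
    finally show ?thesis using k(1) by blast
  qed
  then have "compact (closure ?S)"
    unfolding compact_eq_totally_bounded by (simp add: complete_eq_closed)
  moreover have "a \<in> bop" using bop_LIMSEQ[OF _ lim] f by (simp add: compact_op_def)
  ultimately show ?thesis by (simp add: compact_op_def)
qed

lemma compact_op_diag:
  assumes e: "orthonormal e" and l: "l \<longlonglongrightarrow> 0"
  shows "compact_op (diag e l)"
proof (rule compact_op_LIMSEQ)
  show "(\<lambda>N. \<Sum>n<N. l n *\<^sub>R proj (e n)) \<longlonglongrightarrow> diag e l"
    using diag_sums[OF e l] by (simp add: sums_def)
  fix N
  obtain C where C: "compact C"
    "\<And>c. (\<forall>i\<in>{..<N}. cmod (c i) \<le> \<bar>l i\<bar>) \<Longrightarrow> (\<Sum>i<N. c i *\<^sub>C e i) \<in> C"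
    using compact_combinations[of "{..<N}" "\<lambda>i. \<bar>l i\<bar>" e] by auto
  show "compact_op (\<Sum>n<N. l n *\<^sub>R proj (e n))"
  proof (rule compact_opI[OF _ C(1)])
    fix x :: 'a assume x: "norm x \<le> 1"
    have "cmod (of_real (l i) * cinner x (e i)) \<le> \<bar>l i\<bar>" for i
      using cinner_cauchy_schwarz[of x "e i"] x orthonormal_on_norm[OF e, of i]
      by (auto simp: norm_mult intro!: mult_left_le)
    then have "(\<Sum>i<N. (of_real (l i) * cinner x (e i)) *\<^sub>C e i) \<in> C" by (intro C(2)) auto
    then show "blinfun_apply (\<Sum>n<N. l n *\<^sub>R proj (e n)) x \<in> C"
      by (simp add: blinfun.sum_left blinfun.scaleR_left proj_apply scaleC_of_real[symmetric])
  qed (intro bop_sum bop_scaleR bop_proj)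
qed

text \<open>Membership in \<open>Fpos\<close> speaks of rank only, whereas all the properties of
  \<phi> are stated on \<open>Kpos\<close>; this is the link.\<close>

lemma compact_op_finite_rank:
  assumes "finite_rank a"
  shows "compact_op a"
proof -
  obtain B where B: "finite B" "range (blinfun_apply a) \<subseteq> cvec.span B" and a: "a \<in> bop"
    using assms by (auto simp: finite_rank_def)
  obtain E where E: "finite E" "\<And>b. b \<in> cvec.span B \<Longrightarrow> (\<Sum>u\<in>E. cinner b u *\<^sub>C u) = b"
    using orthonormal_cover[OF B(1)] by blast
  obtain C where C: "compact C"
    "\<And>c. (\<forall>u\<in>E. cmod (c u) \<le> norm a * norm u) \<Longrightarrow> (\<Sum>u\<in>E. c u *\<^sub>C u) \<in> C"
    using compact_combinations[OF E(1), of "\<lambda>u. norm a * norm u" "\<lambda>u. u"] by auto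
  show ?thesis
  proof (rule compact_opI[OF a C(1)])
    fix x :: 'a assume x: "norm x \<le> 1"
    have "norm (blinfun_apply a x) \<le> norm a"
      using norm_blinfun[of a x] x mult_left_le[of "norm x" "norm a"] by simp
    then have "cmod (cinner (blinfun_apply a x) u) \<le> norm a * norm u" for u
      using cinner_cauchy_schwarz[of "blinfun_apply a x" u] mult_right_mono[of _ _ "norm u"]
      by (meson norm_ge_zero order_trans)
    then have "(\<Sum>u\<in>E. cinner (blinfun_apply a x) u *\<^sub>C u) \<in> C" by (intro C(2)) auto
    then show "blinfun_apply a x \<in> C" using E(2) B(2) by (metis rangeI subsetD)
  qed
qed

lemma diag_in_Kpos:
  assumes "orthonormal e" "l \<longlonglongrightarrow> 0" "\<And>n. 0 \<le> l n"
  shows "diag e l \<in> Kpos"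
  using positive_diag[OF assms] compact_op_diag[OF assms(1,2)] by (simp add: Kpos_def)

lemma Fpos_subset_Kpos: "Fpos \<subseteq> Kpos"
  by (auto simp: Fpos_def Kpos_def compact_op_finite_rank)

subsection \<open>The spectral theorem\<close>

lemma positive_Re_Im:
  assumes "positive a"
  shows "0 \<le> Re (cinner (blinfun_apply a x) x)" "Im (cinner (blinfun_apply a x) x) = 0"
  using assms by (auto simp: positive_def complex_nonneg_Reals_iff)

lemma positiveI:
  assumes "a \<in> bop" "\<And>x. 0 \<le> Re (cinner (blinfun_apply a x) x)" "\<And>x. Im (cinner (blinfun_apply a x) x) = 0"
  shows "positive a"
  using assms by (auto simp: positive_def complex_nonneg_Reals_iff)

text \<open>Polarisation: the quadratic form is real at x + y and at x + iy, which fixes the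
  imaginary and the real part of the sesquilinear form respectively.\<close>

lemma positive_selfadjoint:
  assumes "positive a"
  shows "cinner (blinfun_apply a x) y = cinner x (blinfun_apply a y)"
proof -
  have ab: "a \<in> bop" using assms by (simp add: positive_def)
  let ?q = "\<lambda>x y. cinner (blinfun_apply a x) y"
  have 1: "Im (?q x y) + Im (?q y x) = 0"
    using positive_Re_Im(2)[OF assms, of "x + y"] positive_Re_Im(2)[OF assms, of x] positive_Re_Im(2)[OF assms, of y]
    by (simp add: blinfun.add_right cinner_simps)
  have 2: "Re (?q x y) = Re (?q y x)"
    using positive_Re_Im(2)[OF assms, of "x + \<i> *\<^sub>C y"] positive_Re_Im(2)[OF assms, of x] positive_Re_Im(2)[OF assms, of y]
    by (simp add: blinfun.add_right cinner_simps bopD[OF ab])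
  have "?q x y = cnj (?q y x)" using 1 2 by (intro complex_eqI) auto
  then show ?thesis by (simp add: cnj_cinner)
qed

text \<open>The eigenvalue is the supremum \<open>s\<close> of the quadratic form on the unit sphere
  of \<open>M\<close>. The estimate \<open>ax\<close> makes a maximising sequence one of approximate
  eigenvectors, and compactness supplies a convergent subsequence of its images. The invariant
  subspace \<open>M\<close> is a parameter so that eigenvectors can be split off repeatedly.\<close>

lemma top_eigenvector:
  fixes a :: "'a::complex_hilbert_space \<Rightarrow>\<^sub>L 'a"
  assumes a: "a \<in> Kpos" and M: "subspace M" "closed M" "\<And>x. x \<in> M \<Longrightarrow> blinfun_apply a x \<in> M"
    and v: "v \<in> M" "norm v = 1"
  shows "\<exists>e s. e \<in> M \<and> norm e = 1 \<and> 0 \<le> s \<and> blinfun_apply a e = s *\<^sub>R e \<and>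
           (\<forall>x\<in>M. norm (blinfun_apply a x) \<le> s * norm x)"
proof -
  have pos: "positive a" and cmp: "compact (closure (blinfun_apply a ` cball 0 1))"
    using a by (auto simp: Kpos_def compact_op_def)
  define R where "R x = Re (cinner (blinfun_apply a x) x)" for x
  define U where "U = {x \<in> M. norm x = 1}"
  define s where "s = Sup (R ` U)"
  have R0: "0 \<le> R x" for x unfolding R_def by (rule positive_Re_Im(1)[OF pos])
  have Rb: "R x \<le> norm a" if "norm x = 1" for x
  proof -
    have "R x \<le> norm (blinfun_apply a x) * norm x"
      unfolding R_def using complex_Re_le_cmod cinner_cauchy_schwarz order_trans by blast
    also have "\<dots> \<le> norm a" using norm_blinfun[of a x] that by simp
    finally show ?thesis .
  qed
  have bdd: "bdd_above (R ` U)" unfolding U_def using Rb by (intro bdd_aboveI2[of _ _ "norm a"]) auto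
  have ne: "R ` U \<noteq> {}" using v by (auto simp: U_def)
  have Rs: "R x \<le> s" if "x \<in> U" for x unfolding s_def using bdd that by (intro cSUP_upper)
  have s0: "0 \<le> s" using R0[of v] Rs[of v] v by (auto simp: U_def)
  have Rsc: "R (r *\<^sub>R x) = r\<^sup>2 * R x" for r x
    by (simp add: R_def blinfun.scaleR_right cinner_simps power2_eq_square)
  have RM: "R x \<le> s * (norm x)\<^sup>2" if "x \<in> M" for x
  proof (cases "x = 0")
    case False
    then have "(1 / norm x) *\<^sub>R x \<in> U" using that M(1) by (simp add: U_def subspace_scale)
    then have "(1 / norm x)\<^sup>2 * R x \<le> s" using Rs by (simp only: Rsc[symmetric])
    then show ?thesis using False by (simp add: power_divide field_simps)
  qed (simp add: R_def)
  \<comment> \<open>Cauchy-Schwarz for the form of \<open>a\<close>, obtained from positivity of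
    \<open>R\<close> at x - r a(x). The choice r = 1/s gives the bound; if \<open>s = 0\<close>,
    both values of \<open>R\<close> vanish and r = 1 forces a(x) = 0.\<close>
  have ax: "(norm (blinfun_apply a x))\<^sup>2 \<le> s * R x" if x: "x \<in> M" for x
  proof -
    let ?y = "blinfun_apply a x"
    have ex: "R (x - r *\<^sub>R ?y) = R x - 2 * r * (norm ?y)\<^sup>2 + r\<^sup>2 * R ?y" for r
    proof -
      have "cinner (blinfun_apply a ?y) x = cinner ?y ?y" by (rule positive_selfadjoint[OF pos])
      then show ?thesis
        by (simp add: R_def blinfun.diff_right blinfun.scaleR_right cinner_simps cinner_self power2_eq_square algebra_simps)
    qed
    have Ry: "R ?y \<le> s * (norm ?y)\<^sup>2" by (rule RM[OF M(3)[OF x]])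
    show ?thesis
    proof (cases "s = 0")
      case True
      then have "R x \<le> 0" "R ?y \<le> 0" using RM[OF x] Ry by simp_all
      moreover have "0 \<le> R x - 2 * (norm ?y)\<^sup>2 + R ?y"
        using ex[of 1] R0[of "x - 1 *\<^sub>R ?y"] by simp
      ultimately have "(norm ?y)\<^sup>2 \<le> 0" by linarith
      then show ?thesis using True by simp
    next
      case False
      then have sp: "s > 0" using s0 by simp
      have "0 \<le> R x - 2 * (1 / s) * (norm ?y)\<^sup>2 + (1 / s)\<^sup>2 * R ?y"
        using ex[of "1 / s"] R0[of "x - (1 / s) *\<^sub>R ?y"] by simp
      also have "\<dots> \<le> R x - 2 * (1 / s) * (norm ?y)\<^sup>2 + (1 / s)\<^sup>2 * (s * (norm ?y)\<^sup>2)"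
        using Ry by (intro add_left_mono mult_left_mono) auto
      also have "\<dots> = R x - (norm ?y)\<^sup>2 / s"
        using sp by (simp add: field_simps power2_eq_square)
      finally show ?thesis using sp by (simp add: field_simps)
    qed
  qed
  have bound: "norm (blinfun_apply a x) \<le> s * norm x" if x: "x \<in> M" for x
  proof (rule power2_le_imp_le)
    have "(norm (blinfun_apply a x))\<^sup>2 \<le> s * (s * (norm x)\<^sup>2)"
      using ax[OF x] mult_left_mono[OF RM[OF x] s0] by linarith
    then show "(norm (blinfun_apply a x))\<^sup>2 \<le> (s * norm x)\<^sup>2"
      by (simp add: power_mult_distrib power2_eq_square mult_ac)
  qed (use s0 in simp)
  show ?thesis
  proof (cases "s = 0")
    case True
    then show ?thesis using bound[OF v(1)] v bound by (intro exI[of _ v] exI[of _ 0]) auto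
  next
    case False
    then have sp: "s > 0" using s0 by simp
    have "\<exists>x\<in>U. s - 1 / real (Suc n) < R x" for n
    proof -
      have "s - 1 / real (Suc n) < Sup (R ` U)" by (simp add: s_def)
      then show ?thesis using less_cSup_iff[OF ne bdd] by auto
    qed
    then obtain X where X: "\<And>n. X n \<in> U" "\<And>n. s - 1 / real (Suc n) < R (X n)" by metis
    have XM: "X n \<in> M" "norm (X n) = 1" for n using X(1) by (auto simp: U_def)
    have "blinfun_apply a (X n) \<in> closure (blinfun_apply a ` cball 0 1)" for n
      using XM by (intro closure_subset[THEN subsetD] imageI) simp
    then obtain y r where r: "strict_mono r" and y: "((\<lambda>n. blinfun_apply a (X n)) \<circ> r) \<longlonglongrightarrow> y"
      using cmp unfolding compact_def by metis
    have small: "(norm (blinfun_apply a (X n) - s *\<^sub>R X n))\<^sup>2 \<le> s * (1 / real (Suc n))" for n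
    proof -
      have "(norm (blinfun_apply a (X n) - s *\<^sub>R X n))\<^sup>2
          = (norm (blinfun_apply a (X n)))\<^sup>2 + s\<^sup>2 - 2 * (s * R (X n))"
        using sp by (simp add: norm_diff_sq R_def cinner_simps XM)
      also have "\<dots> \<le> s * (s - R (X n))"
        using ax[OF XM(1), of n] by (simp add: algebra_simps power2_eq_square)
      also have "\<dots> \<le> s * (1 / real (Suc n))"
        using X(2)[of n] by (intro mult_left_mono s0) linarith
      finally show ?thesis .
    qed
    have lim0: "(\<lambda>n. s * (1 / real (Suc n))) \<longlonglongrightarrow> s * 0"
      by (intro tendsto_mult tendsto_const) (rule LIMSEQ_Suc[OF lim_1_over_n])
    have "(\<lambda>n. (norm (blinfun_apply a (X n) - s *\<^sub>R X n))\<^sup>2) \<longlonglongrightarrow> 0"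
      by (rule Lim_null_comparison[OF _ lim0[simplified mult_zero_right]])
        (simp only: real_norm_def abs_power2 small eventually_True)
    then have "(\<lambda>n. sqrt ((norm (blinfun_apply a (X n) - s *\<^sub>R X n))\<^sup>2)) \<longlonglongrightarrow> sqrt 0"
      by (rule tendsto_real_sqrt)
    then have "(\<lambda>n. norm (blinfun_apply a (X n) - s *\<^sub>R X n)) \<longlonglongrightarrow> 0" by simp
    then have "(\<lambda>n. blinfun_apply a (X n) - s *\<^sub>R X n) \<longlonglongrightarrow> 0"
      by (rule tendsto_norm_zero_cancel)
    then have "(\<lambda>n. blinfun_apply a (X (r n)) - s *\<^sub>R X (r n)) \<longlonglongrightarrow> 0"
      using LIMSEQ_subseq_LIMSEQ[OF _ r] by (auto simp: o_def)
    moreover have y': "(\<lambda>n. blinfun_apply a (X (r n))) \<longlonglongrightarrow> y" using y by (simp add: o_def)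
    ultimately have "(\<lambda>n. s *\<^sub>R X (r n)) \<longlonglongrightarrow> y" using tendsto_diff by fastforce
    then have "(\<lambda>n. (1 / s) *\<^sub>R s *\<^sub>R X (r n)) \<longlonglongrightarrow> (1 / s) *\<^sub>R y" by (intro tendsto_scaleR tendsto_const)
    \<comment> \<open>Only the images were known to converge. As X(n) differs from its image divided
      by \<open>s\<close> by a null sequence, the vectors themselves converge too.\<close>
    then have lim: "(\<lambda>n. X (r n)) \<longlonglongrightarrow> (1 / s) *\<^sub>R y" using sp by simp
    let ?e = "(1 / s) *\<^sub>R y"
    have "?e \<in> M" using closed_sequentially[OF M(2) _ lim] XM by auto
    moreover have "norm ?e = 1"
    proof -
      have "(\<lambda>n. 1) \<longlonglongrightarrow> norm ?e" using tendsto_norm[OF lim] by (simp only: XM)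
      then show ?thesis by (rule LIMSEQ_unique[OF _ tendsto_const])
    qed
    moreover have "blinfun_apply a ?e = y"
      using blinfun.tendsto[OF tendsto_const lim, of a] y' LIMSEQ_unique by blast
    ultimately show ?thesis using s0 sp bound by (intro exI[of _ ?e] exI[of _ s]) auto
  qed
qed

text \<open>If the eigenvalues stayed above some L > 0, the images of the \<open>e n\<close> would
  be at mutual distance at least L, and no subsequence of them could converge.\<close>

lemma orthonormal_LIMSEQ_0:
  assumes cmp: "compact_op a" and e: "orthonormal e" and ev: "\<And>n. blinfun_apply a (e n) = l n *\<^sub>R e n"
    and l: "decseq l" "\<And>n. 0 \<le> l n"
  shows "l \<longlonglongrightarrow> 0"
proof -
  obtain L where L: "l \<longlonglongrightarrow> L" "\<And>n. L \<le> l n" using decseq_convergent[OF l(1), of 0] l(2) by auto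
  have "L \<le> 0"
  proof (rule ccontr)
    assume "\<not> L \<le> 0"
    then have Lp: "L > 0" by simp
    have "compact (closure (blinfun_apply a ` cball 0 1))" using cmp by (simp add: compact_op_def)
    moreover have "blinfun_apply a (e n) \<in> closure (blinfun_apply a ` cball 0 1)" for n
      using orthonormal_on_norm[OF e, of n] by (intro closure_subset[THEN subsetD] imageI) simp
    ultimately obtain y r where r: "strict_mono r" and y: "((\<lambda>n. blinfun_apply a (e n)) \<circ> r) \<longlonglongrightarrow> y"
      unfolding compact_def by metis
    have "Cauchy ((\<lambda>n. blinfun_apply a (e n)) \<circ> r)" using y by (rule LIMSEQ_imp_Cauchy)
    then obtain N where N: "\<And>m n. m \<ge> N \<Longrightarrow> n \<ge> N \<Longrightarrow>
        norm (blinfun_apply a (e (r m)) - blinfun_apply a (e (r n))) < L"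
      using Lp unfolding Cauchy_iff o_def by meson
    let ?m = "r N" and ?n = "r (Suc N)"
    have neq: "?m \<noteq> ?n" using r by (metis strict_mono_eq n_not_Suc_n)
    have "(norm (blinfun_apply a (e ?m) - blinfun_apply a (e ?n)))\<^sup>2 = (l ?m)\<^sup>2 + (l ?n)\<^sup>2"
      using neq by (simp add: ev norm_diff_sq cinner_simps orthonormal_onD[OF e] orthonormal_on_norm[OF e])
    also have "\<dots> \<ge> L\<^sup>2" using Lp L(2)[of ?m] by (simp add: power_mono add_increasing2)
    finally have "L \<le> norm (blinfun_apply a (e ?m) - blinfun_apply a (e ?n))"
      by (rule power2_le_imp_le) simp
    then show False using N[of N "Suc N"] by simp
  qed
  moreover have "0 \<le> L" using L(1) l(2) by (intro LIMSEQ_le_const) auto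
  ultimately show ?thesis using L(1) by (metis order_antisym)
qed

text \<open>Deflation: split off a top eigenvector of the restriction to the orthogonal complement
  of those already found. In infinite dimension the process never stops; once the range is exhausted
  it continues inside the kernel with \<open>l n = 0\<close>, which matches the completion of a
  finite list of eigenvalues by zeros.\<close>

theorem compact_positive_diagonalizable:
  fixes a :: "'a::complex_hilbert_space \<Rightarrow>\<^sub>L 'a"
  assumes inf: "infinite_dimensional TYPE('a)" and a: "a \<in> Kpos"
  shows "\<exists>e l. orthonormal e \<and> decseq l \<and> l \<longlonglongrightarrow> 0 \<and> a = diag e l"
proof -
  have pos: "positive a" and cmp: "compact_op a" using a by (auto simp: Kpos_def)
  define M where "M B = {x. \<forall>u\<in>B. cinner x u = 0}" for B :: "'a set"
  define good where "good B e s \<longleftrightarrow> e \<in> M B \<and> norm e = 1 \<and> 0 \<le> s \<and> blinfun_apply a e = s *\<^sub>R e \<and>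
           (\<forall>x\<in>M B. norm (blinfun_apply a x) \<le> s * norm x)" for B e s
  \<comment> \<open>That \<open>B\<close> consists of eigenvectors makes its orthogonal complement
    invariant under \<open>a\<close>.\<close>
  have step: "\<exists>e s. good B e s" if B: "finite B" "\<forall>u\<in>B. \<exists>s. blinfun_apply a u = s *\<^sub>R u" for B
  proof -
    obtain v where v: "norm v = 1" "\<forall>u\<in>B. cinner v u = 0"
      using unit_vector_orthogonal[OF inf B(1)] by blast
    have "closed (\<Inter>u\<in>B. {x. cinner x u = 0})"
      by (intro closed_INT ballI closed_Collect_eq continuous_on_const linear_continuous_on
          bounded_bilinear.bounded_linear_left[OF bounded_bilinear_cinner])
    moreover have "(\<Inter>u\<in>B. {x. cinner x u = 0}) = M B" by (auto simp: M_def)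
    ultimately have "closed (M B)" by simp
    moreover have "subspace (M B)" by (auto simp: subspace_def M_def cinner_simps)
    moreover have "blinfun_apply a x \<in> M B" if "x \<in> M B" for x
      unfolding M_def
    proof (intro CollectI ballI)
      fix u assume u: "u \<in> B"
      then obtain s where "blinfun_apply a u = s *\<^sub>R u" using B(2) by blast
      then show "cinner (blinfun_apply a x) u = 0"
        using that u by (simp add: positive_selfadjoint[OF pos] cinner_simps M_def)
    qed
    moreover have "v \<in> M B" using v by (simp add: M_def)
    ultimately show ?thesis unfolding good_def using top_eigenvector[OF a _ _ _ _ v(1), of "M B"] by blast
  qed
  define F where "F B = (SOME e. \<exists>s. good B e s)" for B
  define S where "S = rec_nat {} (\<lambda>_ B. insert (F B) B)"
  define e where "e n = F (S n)" for n
  have S0: "S 0 = {}" and SS: "S (Suc n) = insert (e n) (S n)" for n by (simp_all add: S_def e_def)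
  have Fgood: "\<exists>s. good B (F B) s" if "\<exists>e s. good B e s" for B
    unfolding F_def using that by (rule someI_ex)
  have SP: "finite (S n) \<and> (\<forall>u\<in>S n. \<exists>s. blinfun_apply a u = s *\<^sub>R u)" for n
  proof (induction n)
    case (Suc n)
    then have "\<exists>s. good (S n) (e n) s" unfolding e_def by (intro Fgood step) auto
    then show ?case using Suc by (auto simp: SS good_def)
  qed (simp add: S0)
  have "\<exists>s. good (S n) (e n) s" for n unfolding e_def using SP[of n] by (intro Fgood step) auto
  then obtain l where g: "\<And>n. good (S n) (e n) (l n)" by metis
  have Seq: "S n = e ` {..<n}" for n by (induction n) (auto simp: S0 SS lessThan_Suc)
  have ev: "blinfun_apply a (e n) = l n *\<^sub>R e n" and ne: "norm (e n) = 1" and l0: "0 \<le> l n" for n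
    using g[of n] by (auto simp: good_def)
  have bd: "norm (blinfun_apply a x) \<le> l n * norm x" if "\<And>i. i < n \<Longrightarrow> cinner x (e i) = 0" for n x
    using g[of n] that by (auto simp: good_def M_def Seq)
  have less: "cinner (e n) (e i) = 0" if "i < n" for i n
    using g[of n] that by (auto simp: good_def M_def Seq)
  have e: "orthonormal e"
    unfolding orthonormal_on_def
  proof (intro ballI)
    fix i j
    show "cinner (e i) (e j) = (if i = j then 1 else 0)"
      using less[of i j] less[of j i] ne[of i] cnj_cinner[of "e j" "e i"]
      by (cases i j rule: linorder_cases) (auto simp: norm_eq_1_iff_cinner)
  qed
  have dec: "decseq l"
  proof (rule decseq_SucI)
    fix n
    have "norm (blinfun_apply a (e (Suc n))) \<le> l n * norm (e (Suc n))" by (rule bd) (simp add: less)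
    then show "l (Suc n) \<le> l n" using ne l0[of "Suc n"] by (simp add: ev)
  qed
  have lim: "l \<longlonglongrightarrow> 0" by (rule orthonormal_LIMSEQ_0[OF cmp e ev dec l0])
  \<comment> \<open>The remainder kills the first \<open>n\<close> eigenvectors and acts as
    \<open>a\<close> on the residual \<open>?y\<close>. That residual lies in the n-th complement,
    where \<open>a\<close> is bounded by \<open>l n\<close>.\<close>
  have "norm ((\<Sum>i<n. l i *\<^sub>R proj (e i)) - a) \<le> l n" for n
  proof (rule norm_blinfun_bound[OF l0])
    fix x
    have on: "orthonormal_on {..<n} e" by (rule orthonormal_on_subset[OF e]) simp
    let ?y = "x - (\<Sum>i<n. cinner x (e i) *\<^sub>C e i)"
    have "blinfun_apply a (\<Sum>i<n. cinner x (e i) *\<^sub>C e i) = (\<Sum>i<n. l i *\<^sub>R cinner x (e i) *\<^sub>C e i)"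
      using pos by (simp add: blinfun.sum_right bopD positive_def ev scaleC_scaleR_commute)
    then have "blinfun_apply ((\<Sum>i<n. l i *\<^sub>R proj (e i)) - a) x = - blinfun_apply a ?y"
      by (simp add: blinfun.diff_left blinfun.diff_right blinfun.sum_left blinfun.scaleR_left proj_apply)
    then have "norm (blinfun_apply ((\<Sum>i<n. l i *\<^sub>R proj (e i)) - a) x) = norm (blinfun_apply a ?y)" by simp
    also have "\<dots> \<le> l n * norm ?y" by (rule bd) (use orthonormal_residual(1)[OF on] in simp)
    also have "\<dots> \<le> l n * norm x" by (intro mult_left_mono l0 norm_orthonormal_residual on) simp
    finally show "norm (blinfun_apply ((\<Sum>i<n. l i *\<^sub>R proj (e i)) - a) x) \<le> l n * norm x" .
  qed
  then have "(\<lambda>n. (\<Sum>i<n. l i *\<^sub>R proj (e i)) - a) \<longlonglongrightarrow> 0"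
    by (intro Lim_null_comparison[OF _ lim] always_eventually allI)
  then have "(\<lambda>n. l n *\<^sub>R proj (e n)) sums a" by (simp add: sums_def LIM_zero_cancel)
  then have "a = diag e l" by (rule diag_eqI[symmetric])
  then show ?thesis using e dec lim by blast
qed

subsection \<open>Comparison of eigenvalues\<close>

text \<open>A homogeneous linear system with more unknowns than equations, solved by Gaussian
  elimination. It serves the minimax argument and the vanishing of the eigenvalues of finite rank
  operators.\<close>

lemma exists_null_vector:
  fixes A :: "'i \<Rightarrow> 'j \<Rightarrow> 'k::field"
  assumes "finite J" "finite I" "card J < card I"
  shows "\<exists>c. (\<exists>i\<in>I. c i \<noteq> 0) \<and> (\<forall>j\<in>J. (\<Sum>i\<in>I. c i * A i j) = 0)"
  using assms
proof (induction J arbitrary: I A rule: finite_induct)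
  case empty
  then obtain i where "i \<in> I" by fastforce
  then show ?case by (intro exI[of _ "\<lambda>_. 1"]) auto
next
  case (insert j J)
  show ?case
  proof (cases "\<exists>p\<in>I. A p j \<noteq> 0")
    case True
    then obtain p where p: "p \<in> I" "A p j \<noteq> 0" by blast
    define I' where "I' = I - {p}"
    have I': "finite I'" "I = insert p I'" "p \<notin> I'" using p insert.prems by (auto simp: I'_def)
    have "card J < card I'" using insert.prems insert.hyps I' by simp
    then obtain c where c: "\<exists>i\<in>I'. c i \<noteq> 0"
      "\<forall>k\<in>J. (\<Sum>i\<in>I'. c i * (A i k - A i j / A p j * A p k)) = 0"
      using insert.IH[of I' "\<lambda>i k. A i k - A i j / A p j * A p k"] I'(1) by blast
    \<comment> \<open>Back substitution: the value of \<open>d\<close> at the pivot \<open>p\<close>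
      solves equation \<open>j\<close> for the eliminated unknown.\<close>
    define S where "S = (\<Sum>i\<in>I'. c i * A i j)"
    define d where "d = c(p := - S / A p j)"
    have sum_d: "(\<Sum>i\<in>I. d i * A i k) = - S / A p j * A p k + (\<Sum>i\<in>I'. c i * A i k)" for k
    proof -
      have "(\<Sum>i\<in>I'. d i * A i k) = (\<Sum>i\<in>I'. c i * A i k)"
        using I'(3) by (intro sum.cong) (auto simp: d_def)
      then show ?thesis using I' by (simp add: d_def)
    qed
    have "(\<Sum>i\<in>I. d i * A i k) = 0" if "k \<in> insert j J" for k
    proof (cases "k = j")
      case True
      then show ?thesis using p(2) by (simp add: sum_d S_def)
    next
      case False
      then have "0 = (\<Sum>i\<in>I'. c i * (A i k - A i j / A p j * A p k))" using c(2) that by simp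
      also have "\<dots> = (\<Sum>i\<in>I'. c i * A i k) - S / A p j * A p k"
        by (simp add: S_def sum_subtractf sum_distrib_left sum_distrib_right sum_divide_distrib algebra_simps)
      finally show ?thesis by (simp add: sum_d)
    qed
    moreover have "\<exists>i\<in>I. d i \<noteq> 0" using c(1) I' by (auto simp: d_def)
    ultimately show ?thesis by blast
  next
    case False
    have "card J < card I" using insert.prems insert.hyps by simp
    then obtain c where "\<exists>i\<in>I. c i \<noteq> 0" "\<forall>k\<in>J. (\<Sum>i\<in>I. c i * A i k) = 0"
      using insert.IH insert.prems by blast
    then show ?thesis using False by (intro exI[of _ c]) auto
  qed
qed

lemma decseq_LIMSEQ_0_nonneg: "decseq l \<Longrightarrow> l \<longlonglongrightarrow> (0::real) \<Longrightarrow> 0 \<le> l n"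
  by (rule decseq_ge)

text \<open>The minimax argument: some nonzero vector in the span of the first \<open>n + 1\<close> of the \<open>e\<^sub>i\<close>
  is orthogonal to the first \<open>n\<close> of the \<open>f\<^sub>j\<close>.\<close>

lemma eigenvalue_comparison:
  assumes e: "orthonormal e" "l \<longlonglongrightarrow> 0" "decseq l"
    and f: "orthonormal f" "m \<longlonglongrightarrow> 0" "decseq m"
    and le: "\<And>x. Re (cinner (blinfun_apply (diag e l) x) x) \<le> Re (cinner (blinfun_apply (diag f m) x) x) + c * (norm x)\<^sup>2"
  shows "l n \<le> m n + c"
proof -
  obtain d where d: "\<exists>i\<in>{..n}. d i \<noteq> 0" "\<forall>j\<in>{..<n}. (\<Sum>i\<le>n. d i * cinner (e i) (f j)) = 0"
    using exists_null_vector[of "{..<n}" "{..n}" "\<lambda>i j. cinner (e i) (f j)"] by auto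
  define x where "x = (\<Sum>i\<le>n. d i *\<^sub>C e i)"
  have on: "orthonormal_on {..n} e" by (rule orthonormal_on_subset[OF e(1)]) simp
  have nx: "(norm x)\<^sup>2 = (\<Sum>i\<le>n. (cmod (d i))\<^sup>2)"
    unfolding x_def by (rule norm_sq_orthonormal_sum[OF on]) simp
  obtain i where "i \<le> n" "d i \<noteq> 0" using d(1) by auto
  then have "0 < (norm x)\<^sup>2" unfolding nx by (intro sum_pos2[of _ i]) auto
  have xe: "cinner x (e k) = (if k \<le> n then d k else 0)" for k
  proof (cases "k \<le> n")
    case False
    then show ?thesis unfolding x_def cinner_sum_left
      using orthonormal_onD[OF e(1)] by (auto intro!: sum.neutral simp: cinner_scaleC_left)
  qed (use cinner_orthonormal_sum[OF on, of k d] in \<open>simp add: x_def\<close>)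
  have xf: "cinner x (f j) = 0" if "j < n" for j
    using d(2) that by (simp add: x_def cinner_sum_left cinner_scaleC_left)
  have "(\<lambda>k. l k * (cmod (cinner x (e k)))\<^sup>2) sums (\<Sum>k\<le>n. l k * (cmod (cinner x (e k)))\<^sup>2)"
    by (rule sums_finite) (auto simp: xe)
  then have "Re (cinner (blinfun_apply (diag e l) x) x) = (\<Sum>k\<le>n. l k * (cmod (cinner x (e k)))\<^sup>2)"
    using cinner_diag_self_sums(1)[OF e(1,2), of x] sums_unique2 by blast
  also have "\<dots> \<ge> (\<Sum>k\<le>n. l n * (cmod (d k))\<^sup>2)"
    using e(3) by (intro sum_mono) (auto simp: xe decseq_def intro!: mult_right_mono)
  finally have lower: "l n * (norm x)\<^sup>2 \<le> Re (cinner (blinfun_apply (diag e l) x) x)"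
    by (simp add: nx sum_distrib_left)
  have m0: "0 \<le> m n" by (rule decseq_LIMSEQ_0_nonneg[OF f(3,2)])
  have upper: "Re (cinner (blinfun_apply (diag f m) x) x) \<le> m n * (norm x)\<^sup>2"
  proof (rule LIMSEQ_le_const2)
    show "(\<lambda>N. \<Sum>k<N. m k * (cmod (cinner x (f k)))\<^sup>2) \<longlonglongrightarrow> Re (cinner (blinfun_apply (diag f m) x) x)"
      using cinner_diag_self_sums(1)[OF f(1,2), of x] by (simp add: sums_def)
    \<comment> \<open>The terms with k < n vanish because \<open>x\<close> is orthogonal to those
      \<open>f k\<close>; in the others \<open>m k\<close> is at most \<open>m n\<close>, and
      Bessel's inequality bounds the sum.\<close>
    have "(\<Sum>k<N. m k * (cmod (cinner x (f k)))\<^sup>2) \<le> m n * (norm x)\<^sup>2" for N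
    proof -
      have "(\<Sum>k<N. m k * (cmod (cinner x (f k)))\<^sup>2) \<le> (\<Sum>k<N. m n * (cmod (cinner x (f k)))\<^sup>2)"
      proof (rule sum_mono)
        fix k
        show "m k * (cmod (cinner x (f k)))\<^sup>2 \<le> m n * (cmod (cinner x (f k)))\<^sup>2"
          using xf[of k] f(3) by (cases "k < n") (auto simp: decseq_def intro!: mult_right_mono)
      qed
      also have "\<dots> \<le> m n * (norm x)\<^sup>2"
        unfolding sum_distrib_left[symmetric]
        by (intro mult_left_mono m0 bessel orthonormal_on_subset[OF f(1)]) auto
      finally show ?thesis .
    qed
    then show "\<exists>N. \<forall>n'\<ge>N. (\<Sum>k<n'. m k * (cmod (cinner x (f k)))\<^sup>2) \<le> m n * (norm x)\<^sup>2" by blast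
  qed
  have "l n * (norm x)\<^sup>2 \<le> (m n + c) * (norm x)\<^sup>2"
    using lower upper le[of x] by (simp add: algebra_simps)
  then show ?thesis using \<open>0 < (norm x)\<^sup>2\<close> by (simp only: mult_le_cancel_right_pos)
qed

section \<open>Rank one projections and uniqueness of the eigenvalue sequence\<close>

lemma rank_one_projection_proj:
  assumes "norm e = 1"
  shows "rank_one_projection (proj e)"
proof -
  have ee: "cinner e e = 1" using assms by (simp add: norm_eq_1_iff_cinner)
  have "range (blinfun_apply (proj e)) = cvec.span {e}"
  proof -
    have "c *\<^sub>C e = blinfun_apply (proj e) (c *\<^sub>C e)" for c
      by (simp add: proj_apply cinner_simps ee)
    then have "c *\<^sub>C e \<in> range (blinfun_apply (proj e))" for c by (metis rangeI)
    then show ?thesis unfolding cvec.span_singleton by (auto simp: proj_apply)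
  qed
  moreover have "cvec.dim (cvec.span {e}) = 1"
    using assms by (subst cvec.dim_span_eq_card_independent) auto
  moreover have "proj e o\<^sub>L proj e = proj e"
    by (rule blinfun_eqI) (simp add: proj_apply cinner_simps ee)
  moreover have "adj (proj e) = proj e"
    by (rule adj_eqI[OF bop_proj]) (simp add: proj_apply cinner_simps cnj_cinner)
  ultimately show ?thesis by (simp add: rank_one_projection_def bop_proj)
qed

lemma rank_one_projectionE:
  assumes "rank_one_projection p"
  obtains e where "norm e = 1" "p = proj e"
proof -
  have p: "p \<in> bop" "p o\<^sub>L p = p" "adj p = p" "cvec.dim (range (blinfun_apply p)) = 1"
    using assms by (auto simp: rank_one_projection_def)
  obtain B where B: "B \<subseteq> range (blinfun_apply p)" "cvec.independent B"
      "range (blinfun_apply p) \<subseteq> cvec.span B" "card B = cvec.dim (range (blinfun_apply p))"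
    using cvec.basis_exists by blast
  then obtain v where v: "B = {v}" using p(4) card_1_singletonE by metis
  have v0: "v \<noteq> 0" using B(2) v by auto
  have pp: "blinfun_apply p (blinfun_apply p x) = blinfun_apply p x" for x
    using p(2) by (metis blinfun_apply_blinfun_compose)
  have pv: "blinfun_apply p v = v" using B(1) v pp by auto
  define e where "e = (1 / norm v) *\<^sub>R v"
  have ne: "norm e = 1" using v0 by (simp add: e_def)
  have ee: "cinner e e = 1" using ne by (simp add: norm_eq_1_iff_cinner)
  have pe: "blinfun_apply p e = e" by (simp add: e_def blinfun.scaleR_right pv)
  have "p = proj e"
  proof (rule blinfun_eqI)
    fix x
    have "blinfun_apply p x \<in> cvec.span {v}" using B(3) v by auto
    then obtain c where "blinfun_apply p x = c *\<^sub>C v" by (auto simp: cvec.span_singleton)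
    also have "v = of_real (norm v) *\<^sub>C e" using v0 by (simp add: e_def scaleC_of_real)
    finally have c: "blinfun_apply p x = (c * of_real (norm v)) *\<^sub>C e" by simp
    \<comment> \<open>The range being a line gives p(x) up to a scalar; self-adjointness and p(e) =
      e determine that scalar.\<close>
    have "cinner (blinfun_apply p x) e = cinner x e"
      using cinner_adj(2)[OF p(1), of x e] by (simp add: p(3) pe)
    then show "blinfun_apply p x = blinfun_apply (proj e) x"
      by (simp add: c proj_apply cinner_simps ee)
  qed
  then show ?thesis using ne that by blast
qed

text \<open>Any competing decomposition consists of projections onto the lines of another
  orthonormal sequence, so it is a diagonal form of the same operator. Comparison with error 0 in
  both directions then identifies the two sequences, which makes the description in
  \<open>eigval_def\<close> meaningful.\<close>

lemma eigval_diag: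
  assumes e: "orthonormal e" "l \<longlonglongrightarrow> 0" "decseq l"
  shows "eigval (diag e l) = l"
  unfolding eigval_def
proof (rule the_equality)
  have "proj (e m) o\<^sub>L proj (e n) = 0" if "m \<noteq> n" for m n
    by (rule blinfun_eqI) (use that orthonormal_onD[OF e(1)] in \<open>simp add: proj_apply cinner_simps\<close>)
  then show "decseq l \<and> l \<longlonglongrightarrow> 0 \<and> (\<exists>p. (\<forall>n. rank_one_projection (p n)) \<and>
      (\<forall>m n. m \<noteq> n \<longrightarrow> p m o\<^sub>L p n = 0) \<and> (\<lambda>n. l n *\<^sub>R p n) sums diag e l)"
    using diag_sums[OF e(1,2)] orthonormal_on_norm[OF e(1)] e(2,3)
    by (intro conjI exI[of _ "\<lambda>n. proj (e n)"]) (auto intro: rank_one_projection_proj)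
next
  fix k assume k: "decseq k \<and> k \<longlonglongrightarrow> 0 \<and> (\<exists>p. (\<forall>n. rank_one_projection (p n)) \<and>
      (\<forall>m n. m \<noteq> n \<longrightarrow> p m o\<^sub>L p n = 0) \<and> (\<lambda>n. k n *\<^sub>R p n) sums diag e l)"
  then obtain p where p: "\<And>n. rank_one_projection (p n)" "\<And>m n. m \<noteq> n \<Longrightarrow> p m o\<^sub>L p n = 0"
    "(\<lambda>n. k n *\<^sub>R p n) sums diag e l" by blast
  have "\<exists>f. norm f = 1 \<and> p n = proj f" for n using rank_one_projectionE[OF p(1)] by metis
  then obtain f where f: "\<And>n. norm (f n) = 1" "\<And>n. p n = proj (f n)" by metis
  have ff: "cinner (f n) (f n) = 1" for n using f(1) by (simp add: norm_eq_1_iff_cinner)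
  have "cinner (f n) (f m) = 0" if "m \<noteq> n" for m n
  proof -
    have "blinfun_apply (p m o\<^sub>L p n) (f n) = 0" using p(2)[OF that] by simp
    then have "cinner (f n) (f m) *\<^sub>C f m = 0" by (simp add: f(2) proj_apply cinner_simps ff)
    then have "cmod (cinner (f n) (f m)) * norm (f m) = 0" by (simp only: norm_scaleC[symmetric] norm_zero)
    then show ?thesis using f(1) by simp
  qed
  then have on: "orthonormal f" by (simp add: orthonormal_on_def ff)
  have dk: "diag f k = diag e l" using p(3) by (intro diag_eqI) (simp add: f(2))
  show "k = l"
  proof (rule ext, rule order_antisym)
    fix n
    show "k n \<le> l n" using eigenvalue_comparison[of f k e l 0 n] on k e by (simp add: dk)
    show "l n \<le> k n" using eigenvalue_comparison[of e l f k 0 n] on k e by (simp add: dk)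
  qed
qed

subsection \<open>Functional calculus\<close>

text \<open>The point 0 always belongs to the spectrum, even for an injective operator, because the
  entries accumulate there.\<close>

lemma real_spectrum_diag:
  fixes e :: "nat \<Rightarrow> 'a::complex_hilbert_space"
  assumes e: "orthonormal e" and l: "l \<longlonglongrightarrow> 0"
  shows "real_spectrum (diag e l) = insert 0 (range l)"
proof (intro equalityI subsetI)
  fix t assume t: "t \<in> real_spectrum (diag e l)"
  show "t \<in> insert 0 (range l)"
  proof (rule ccontr)
    assume "t \<notin> insert 0 (range l)"
    then have t0: "t \<noteq> 0" and tl: "\<And>n. l n - t \<noteq> 0" by auto
    \<comment> \<open>The resolvent has entries 1/(l n - t), which do not tend to 0. Splitting off
      its value -1/t on the kernel leaves 1/(l n - t) + 1/t, which is \<open>m n\<close>.\<close>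
    define m where "m n = l n / (t * (l n - t))" for n
    have m: "m \<longlonglongrightarrow> 0"
    proof -
      have "m \<longlonglongrightarrow> 0 / (t * (0 - t))"
        unfolding m_def using t0 by (intro tendsto_intros l) auto
      then show ?thesis by simp
    qed
    have id: "l n * m n - t * m n = 1 / t * l n" for n
    proof -
      have "l n * m n - t * m n = (l n - t) * m n" by (simp add: algebra_simps)
      also have "\<dots> = 1 / t * l n" using t0 tl[of n] by (simp add: m_def)
      finally show ?thesis .
    qed
    let ?a = "diag e l"
    define b where "b = diag e m - (1 / t) *\<^sub>R id_blinfun"
    have bb: "b \<in> bop" unfolding b_def by (intro bop_diff bop_scaleR bop_id bop_diag e m)
    have lm: "(\<lambda>n. l n * m n) \<longlonglongrightarrow> 0" "(\<lambda>n. t * m n) \<longlonglongrightarrow> 0"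
      using tendsto_mult[OF l m] tendsto_mult[OF tendsto_const[of t] m] by simp_all
    have "diag e (\<lambda>n. l n * m n) - t *\<^sub>R diag e m = (1 / t) *\<^sub>R ?a"
      unfolding diag_scaleR[OF e m, symmetric] diag_scaleR[OF e l, symmetric] diag_diff[OF e lm, symmetric] id ..
    then have key: "blinfun_apply (diag e (\<lambda>n. l n * m n)) x - t *\<^sub>R blinfun_apply (diag e m) x
        = (1 / t) *\<^sub>R blinfun_apply ?a x" for x
      by (metis blinfun.diff_left blinfun.scaleR_left)
    have ab: "blinfun_apply ?a (blinfun_apply (diag e m) x) = blinfun_apply (diag e (\<lambda>n. l n * m n)) x"
      and ba: "blinfun_apply (diag e m) (blinfun_apply ?a x) = blinfun_apply (diag e (\<lambda>n. l n * m n)) x" for x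
      by (simp_all add: compose_diag[OF e m l, symmetric] compose_diag[OF e l m, symmetric] blinfun_apply_blinfun_compose[symmetric]
          del: blinfun_apply_blinfun_compose) (simp add: compose_diag e m l mult.commute)
    have "blinfun_apply b (blinfun_apply ?a x - of_real t *\<^sub>C x) = x" for x
      using key[of x] t0
      by (simp add: b_def scaleC_of_real blinfun.diff_left blinfun.diff_right blinfun.scaleR_left blinfun.scaleR_right ba algebra_simps)
    moreover have "blinfun_apply ?a (blinfun_apply b x) - of_real t *\<^sub>C blinfun_apply b x = x" for x
      using key[of x] t0
      by (simp add: b_def scaleC_of_real blinfun.diff_left blinfun.diff_right blinfun.scaleR_left blinfun.scaleR_right ab algebra_simps)
    ultimately show False using t bb unfolding real_spectrum_def spectrum_def by blast
  qed
next
  fix t assume t: "t \<in> insert 0 (range l)"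
  show "t \<in> real_spectrum (diag e l)"
    unfolding real_spectrum_def spectrum_def
  proof (intro CollectI notI)
    assume "\<exists>b\<in>bop. \<forall>x. blinfun_apply b (blinfun_apply (diag e l) x - complex_of_real t *\<^sub>C x) = x \<and>
        blinfun_apply (diag e l) (blinfun_apply b x) - complex_of_real t *\<^sub>C blinfun_apply b x = x"
    then obtain b where b: "\<And>x. blinfun_apply b (blinfun_apply (diag e l) x - t *\<^sub>R x) = x"
      by (auto simp: scaleC_of_real)
    have be: "(l n - t) *\<^sub>R blinfun_apply b (e n) = e n" for n
      using b[of "e n"] by (simp add: diag_eigenvector[OF e l] blinfun.scaleR_right flip: scaleR_diff_left)
    \<comment> \<open>A bounded left inverse keeps \<open>t\<close> at a positive distance from all
      entries; this excludes both an entry itself and their limit 0.\<close>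
    have one: "1 \<le> \<bar>l n - t\<bar> * norm b" for n
    proof -
      have "1 = \<bar>l n - t\<bar> * norm (blinfun_apply b (e n))"
        using arg_cong[OF be[of n], of norm] orthonormal_on_norm[OF e, of n] by simp
      also have "\<dots> \<le> \<bar>l n - t\<bar> * (norm b * norm (e n))" by (intro mult_left_mono norm_blinfun) simp
      finally show ?thesis using orthonormal_on_norm[OF e, of n] by simp
    qed
    from t show False
    proof
      assume "t = 0"
      then have "1 \<le> \<bar>0\<bar> * norm b"
        using one by (intro LIMSEQ_le_const[where X = "\<lambda>n. \<bar>l n\<bar> * norm b"] tendsto_intros l) auto
      then show False by simp
    next
      assume "t \<in> range l"
      then obtain k where "t = l k" by blast
      then show False using one[of k] by simp
    qed
  qed
qed

lemma diag_sum:
  assumes e: "orthonormal e" and "finite F" "\<And>i. i \<in> F \<Longrightarrow> L i \<longlonglongrightarrow> 0"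
  shows "diag e (\<lambda>k. \<Sum>i\<in>F. L i k) = (\<Sum>i\<in>F. diag e (L i))"
  using assms(2,3)
proof (induction F)
  case (insert i F)
  have "(\<lambda>k. \<Sum>i\<in>F. L i k) \<longlonglongrightarrow> (\<Sum>i\<in>F. 0)" using insert by (intro tendsto_sum) auto
  then show ?case using insert diag_add[OF e, of "L i" "\<lambda>k. \<Sum>i\<in>F. L i k"] by simp
qed simp

text \<open>The zeroth power is the identity, which is not diagonal in the present sense. The factor
  \<open>0 ^ i\<close> splits it off and is 1 exactly for \<open>i = 0\<close>; for polynomials it
  leaves the constant term \<open>poly P 0\<close>.\<close>

lemma op_power_diag:
  assumes e: "orthonormal e" and l: "l \<longlonglongrightarrow> 0"
  shows "op_power (diag e l) i = 0 ^ i *\<^sub>R id_blinfun + diag e (\<lambda>k. l k ^ i - 0 ^ i)"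
    and "(\<lambda>k. l k ^ i - 0 ^ i) \<longlonglongrightarrow> 0"
proof -
  have lim: "(\<lambda>k. l k ^ i) \<longlonglongrightarrow> 0 ^ i" for i by (intro tendsto_power l)
  show "(\<lambda>k. l k ^ i - 0 ^ i) \<longlonglongrightarrow> 0" using lim[of i] by (simp add: LIM_zero)
  have comp: "diag e l o\<^sub>L diag e (\<lambda>k. l k ^ Suc n) = diag e (\<lambda>k. l k ^ Suc (Suc n))" for n
    using compose_diag[OF e _ l, of "\<lambda>k. l k ^ Suc n"] lim[of "Suc n"] by simp
  have "op_power (diag e l) (Suc n) = diag e (\<lambda>k. l k ^ Suc n)" for n
  proof (induction n)
    case (Suc n)
    have "op_power (diag e l) (Suc (Suc n)) = diag e l o\<^sub>L op_power (diag e l) (Suc n)"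
      by (simp add: op_power_def)
    then show ?case by (simp only: Suc comp)
  qed (auto simp: op_power_def intro!: blinfun_eqI)
  then show "op_power (diag e l) i = 0 ^ i *\<^sub>R id_blinfun + diag e (\<lambda>k. l k ^ i - 0 ^ i)"
    by (cases i) (simp_all add: op_power_def)
qed

lemma op_poly_diag:
  assumes e: "orthonormal e" and l: "l \<longlonglongrightarrow> 0"
  shows "op_poly P (diag e l) = poly P 0 *\<^sub>R id_blinfun + diag e (\<lambda>k. poly P (l k) - poly P 0)"
proof -
  let ?c = "coeff P"
  have lim: "(\<lambda>k. ?c i * (l k ^ i - 0 ^ i)) \<longlonglongrightarrow> 0" for i
    using tendsto_mult[OF tendsto_const[of "?c i"] op_power_diag(2)[OF e l, of i]] by simp
  have "op_poly P (diag e l) = (\<Sum>i\<le>degree P. (?c i * 0 ^ i) *\<^sub>R id_blinfun + diag e (\<lambda>k. ?c i * (l k ^ i - 0 ^ i)))"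
    unfolding op_poly_def
    by (simp add: op_power_diag(1)[OF e l] diag_scaleR[OF e op_power_diag(2)[OF e l]] scaleR_add_right)
  also have "\<dots> = poly P 0 *\<^sub>R id_blinfun + diag e (\<lambda>k. \<Sum>i\<le>degree P. ?c i * (l k ^ i - 0 ^ i))"
    unfolding sum.distrib scaleR_sum_left[symmetric] poly_altdef[symmetric]
    by (subst diag_sum[OF e]) (use lim in auto)
  also have "(\<lambda>k. \<Sum>i\<le>degree P. ?c i * (l k ^ i - 0 ^ i)) = (\<lambda>k. poly P (l k) - poly P 0)"
    by (simp add: poly_altdef[of P] right_diff_distrib sum_subtractf)
  finally show ?thesis .
qed

lemma real_polynomial_function_poly:
  assumes "real_polynomial_function g"
  shows "\<exists>P. \<forall>x. g x = poly P x"
proof -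
  obtain a n where "g = (\<lambda>x. \<Sum>i\<le>n. a i * x ^ i)"
    using assms real_polynomial_function_iff_sum by blast
  then have "g x = poly (\<Sum>i\<le>n. monom (a i) i) x" for x by (simp add: poly_sum poly_monom)
  then show ?thesis by blast
qed

text \<open>Continuity is known only on the spectrum, and that is enough because the limit 0 of the
  entries belongs to it.\<close>

lemma LIMSEQ_spectrum:
  assumes "orthonormal e" "l \<longlonglongrightarrow> 0" "continuous_on (real_spectrum (diag e l)) f" "f 0 = 0"
  shows "(\<lambda>n. f (l n)) \<longlonglongrightarrow> 0"
  using assms(3) continuous_on_tendsto_compose[of "insert 0 (range l)" f l 0 sequentially] assms(2,4)
  by (simp add: real_spectrum_diag[OF assms(1,2)])

text \<open>Every approximating sequence of polynomials leads to the same limit, and Weierstrass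
  approximation provides one; together they resolve the definite description. Since
  \<open>f 0 = 0\<close>, the scalar part of P(a) disappears in the limit.\<close>

lemma fun_calc_diag:
  assumes e: "orthonormal e" and l: "l \<longlonglongrightarrow> 0"
    and f: "continuous_on (real_spectrum (diag e l)) f" "f 0 = 0"
  shows "fun_calc f (diag e l) = diag e (\<lambda>n. f (l n))"
proof -
  let ?a = "diag e l" and ?S = "real_spectrum (diag e l)"
  have S: "?S = insert 0 (range l)" by (rule real_spectrum_diag[OF e l])
  have fl: "(\<lambda>n. f (l n)) \<longlonglongrightarrow> 0" by (rule LIMSEQ_spectrum[OF e l f])
  have lim: "(\<lambda>n. op_poly (P n) ?a) \<longlonglongrightarrow> diag e (\<lambda>n. f (l n))"
    if P: "uniform_limit ?S (\<lambda>n. poly (P n)) f sequentially" for P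
  proof (rule LIMSEQ_I)
    fix r :: real assume r: "r > 0"
    obtain N where N: "\<And>n x. n \<ge> N \<Longrightarrow> x \<in> ?S \<Longrightarrow> \<bar>poly (P n) x - f x\<bar> < r / 4"
      using uniform_limitD[OF P, of "r / 4"] r by (auto simp: eventually_sequentially dist_real_def)
    have "norm (op_poly (P n) ?a - diag e (\<lambda>n. f (l n))) < r" if n: "n \<ge> N" for n
    proof -
      let ?p = "poly (P n)"
      have "isCont ?p 0" by simp
      then have pl: "(\<lambda>k. ?p (l k)) \<longlonglongrightarrow> ?p 0" using l isCont_tendsto_compose by blast
      then have lim1: "(\<lambda>k. ?p (l k) - ?p 0) \<longlonglongrightarrow> 0" by (simp add: LIM_zero)
      \<comment> \<open>Error budget: r/4 for the scalar part, and r/4 + r/4 for the diagonal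
        entries, from which \<open>?p 0\<close> has been subtracted.\<close>
      have small: "\<bar>?p 0\<bar> < r / 4" "\<And>k. \<bar>?p (l k) - f (l k)\<bar> < r / 4"
        using N[OF n, of 0] N[OF n] f(2) by (auto simp: S)
      have "op_poly (P n) ?a - diag e (\<lambda>n. f (l n))
          = ?p 0 *\<^sub>R id_blinfun + diag e (\<lambda>k. ?p (l k) - ?p 0 - f (l k))"
        by (simp add: op_poly_diag[OF e l] diag_diff[OF e lim1 fl])
      also have "norm \<dots> \<le> norm (?p 0 *\<^sub>R (id_blinfun :: 'a \<Rightarrow>\<^sub>L 'a)) + norm (diag e (\<lambda>k. ?p (l k) - ?p 0 - f (l k)))"
        by (rule norm_triangle_ineq)
      also have "norm (?p 0 *\<^sub>R (id_blinfun :: 'a \<Rightarrow>\<^sub>L 'a)) \<le> \<bar>?p 0\<bar>"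
        by (simp add: mult_left_le norm_blinfun_id_le)
      also have "norm (diag e (\<lambda>k. ?p (l k) - ?p 0 - f (l k))) \<le> r / 2"
      proof (rule norm_diag_le[OF e])
        show "(\<lambda>k. ?p (l k) - ?p 0 - f (l k)) \<longlonglongrightarrow> 0" using tendsto_diff[OF lim1 fl] by simp
        show "\<bar>?p (l k) - ?p 0 - f (l k)\<bar> \<le> r / 2" for k using small(1) small(2)[of k] by linarith
      qed
      finally show ?thesis using small(1) r by simp
    qed
    then show "\<exists>no. \<forall>n\<ge>no. norm (op_poly (P n) ?a - diag e (\<lambda>n. f (l n))) < r" by blast
  qed
  have "\<exists>P. \<forall>x\<in>?S. \<bar>f x - poly P x\<bar> < 1 / real (Suc n)" for n
  proof -
    have "compact ?S" unfolding S by (rule compact_sequence_with_limit[OF l])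
    then obtain g where "real_polynomial_function g" "\<And>x. x \<in> ?S \<Longrightarrow> \<bar>f x - g x\<bar> < 1 / real (Suc n)"
      using Stone_Weierstrass_real_polynomial_function[OF _ f(1), of "1 / real (Suc n)"] by auto
    then show ?thesis using real_polynomial_function_poly by metis
  qed
  then obtain P where P: "\<And>n x. x \<in> ?S \<Longrightarrow> \<bar>f x - poly (P n) x\<bar> < 1 / real (Suc n)" by metis
  have ul: "uniform_limit ?S (\<lambda>n. poly (P n)) f sequentially"
  proof (rule uniform_limitI)
    fix r :: real assume "r > 0"
    then obtain N where N: "1 / real (Suc N) < r" using nat_approx_posE by blast
    have "dist (poly (P n) x) (f x) < r" if "n \<ge> N" "x \<in> ?S" for n x
    proof -
      have "1 / real (Suc n) \<le> 1 / real (Suc N)" using that by (simp add: field_simps)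
      then show ?thesis using P[OF that(2), of n] N by (simp add: dist_real_def abs_minus_commute)
    qed
    then show "\<forall>\<^sub>F n in sequentially. \<forall>x\<in>?S. dist (poly (P n) x) (f x) < r"
      unfolding eventually_sequentially by blast
  qed
  show ?thesis
    unfolding fun_calc_def
    by (rule the_equality) (use ul lim LIMSEQ_unique in blast)+
qed

subsection \<open>Traces of Choquet type\<close>

lemma Kpos_diagE:
  fixes a :: "'a::complex_hilbert_space \<Rightarrow>\<^sub>L 'a"
  assumes "infinite_dimensional TYPE('a)" "a \<in> Kpos"
  obtains e l where "orthonormal e" "l \<longlonglongrightarrow> 0" "decseq l" "a = diag e l"
  using compact_positive_diagonalizable[OF assms] by blast

section \<open>Summation by parts and sorting of null sequences\<close>

lemma suminf_swap_ennreal: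
  fixes f :: "nat \<Rightarrow> nat \<Rightarrow> ennreal"
  shows "(\<Sum>n. \<Sum>j. f n j) = (\<Sum>j. \<Sum>n. f n j)"
  using nn_integral_suminf[of "\<lambda>j n. f n j" "count_space UNIV"]
  by (simp add: nn_integral_count_space_nat)

text \<open>Write \<alpha>(n + 1) as the sum of its increments up to n and exchange the two
  summations. All terms are nonnegative, so Tonelli applies and the value infinity is
  covered.\<close>

lemma suminf_abel_summation:
  fixes l \<alpha> :: "nat \<Rightarrow> real"
  assumes l: "decseq l" "l \<longlonglongrightarrow> 0" and \<alpha>: "mono \<alpha>" "\<alpha> 0 = 0"
  shows "(\<Sum>n. ennreal ((l n - l (Suc n)) * \<alpha> (Suc n))) = (\<Sum>n. ennreal (l n * (\<alpha> (Suc n) - \<alpha> n)))"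
proof -
  define c where "c j = \<alpha> (Suc j) - \<alpha> j" for j
  have c0: "0 \<le> c j" for j using \<alpha>(1) by (simp add: c_def mono_def)
  have dl: "0 \<le> l n - l (Suc n)" for n using l(1) by (simp add: decseq_Suc_iff)
  let ?f = "\<lambda>n j. ennreal ((if j \<le> n then l n - l (Suc n) else 0) * c j)"
  have "ennreal ((l n - l (Suc n)) * \<alpha> (Suc n)) = (\<Sum>j. ?f n j)" for n
  proof -
    have "\<alpha> (Suc n) = (\<Sum>j\<le>n. c j)"
      using sum_lessThan_telescope[of \<alpha> "Suc n"] \<alpha>(2) by (simp add: c_def lessThan_Suc_atMost)
    then have "ennreal ((l n - l (Suc n)) * \<alpha> (Suc n)) = (\<Sum>j\<le>n. ennreal ((l n - l (Suc n)) * c j))"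
      using c0 dl by (simp add: sum_distrib_left)
    also have "\<dots> = (\<Sum>j\<le>n. ?f n j)" by (intro sum.cong) auto
    also have "\<dots> = (\<Sum>j. ?f n j)" by (intro suminf_finite[symmetric]) auto
    finally show ?thesis .
  qed
  then have "(\<Sum>n. ennreal ((l n - l (Suc n)) * \<alpha> (Suc n))) = (\<Sum>n. \<Sum>j. ?f n j)"
    by (simp only:)
  also have "\<dots> = (\<Sum>j. \<Sum>n. ?f n j)" by (rule suminf_swap_ennreal)
  finally have "(\<Sum>n. ennreal ((l n - l (Suc n)) * \<alpha> (Suc n))) = (\<Sum>j. \<Sum>n. ?f n j)" .
  moreover have "(\<Sum>n. ?f n j) = ennreal (l j * c j)" for j
  proof (rule suminf_ennreal_eq)
    \<comment> \<open>Freezing \<open>l\<close> up to index \<open>j\<close> by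
      \<open>max j n\<close> turns the sum over n >= j into a telescoping series that starts at
      0.\<close>
    have "(\<lambda>n. l (max j n)) \<longlonglongrightarrow> 0"
    proof (rule Lim_transform_eventually[OF l(2)])
      show "\<forall>\<^sub>F n in sequentially. l n = l (max j n)"
        by (rule eventually_sequentiallyI[of j]) (simp add: max_def)
    qed
    then have "(\<lambda>n. l (max j n) - l (max j (Suc n))) sums (l (max j 0) - 0)" by (rule telescope_sums')
    moreover have "l (max j n) - l (max j (Suc n)) = (if j \<le> n then l n - l (Suc n) else 0)" for n
      by (auto simp: max_def not_le le_Suc_eq)
    ultimately have "(\<lambda>n. if j \<le> n then l n - l (Suc n) else 0) sums l j" by simp
    then show "(\<lambda>n. (if j \<le> n then l n - l (Suc n) else 0) * c j) sums (l j * c j)"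
      by (rule sums_mult2)
  qed (use c0 dl in auto)
  ultimately show ?thesis by (simp only: c_def)
qed

lemma choquet_trace_diag:
  assumes "orthonormal e" "l \<longlonglongrightarrow> 0" "decseq l" "mono \<alpha>" "\<alpha> 0 = 0"
  shows "choquet_trace \<alpha> (diag e l) = (\<Sum>n. ennreal (l n * (\<alpha> (Suc n) - \<alpha> n)))"
  unfolding choquet_trace_def eigval_diag[OF assms(1-3)]
  by (rule suminf_abel_summation) (use assms in auto)

lemma sorted_enumeration:
  fixes h :: "nat \<Rightarrow> real"
  assumes h0: "\<And>n. 0 \<le> h n" and h: "h \<longlonglongrightarrow> 0"
  obtains s :: "nat \<Rightarrow> nat" where "inj s" "decseq (\<lambda>n. h (s n))" "\<And>k. k \<notin> range s \<Longrightarrow> h k = 0"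
proof -
  have ex: "\<exists>k. k \<notin> A \<and> (\<forall>j. j \<notin> A \<longrightarrow> h j \<le> h k)" if A: "finite A" for A
  proof (cases "\<exists>j. j \<notin> A \<and> h j > 0")
    case True
    then obtain i where i: "i \<notin> A" "h i > 0" by blast
    \<comment> \<open>One positive value leaves only finitely many competitors, since
      \<open>h\<close> tends to 0; so a maximum exists.\<close>
    define T where "T = {j. j \<notin> A \<and> h i \<le> h j}"
    obtain N where N: "\<And>n. n \<ge> N \<Longrightarrow> \<bar>h n\<bar> < h i"
      using LIMSEQ_D[OF h i(2)] by auto
    have "T \<subseteq> {..<N}"
    proof
      fix j assume "j \<in> T"
      then have "h i \<le> h j" by (simp add: T_def)
      then have "\<not> \<bar>h j\<bar> < h i" by linarith
      then show "j \<in> {..<N}" using N[of j] by (meson lessThan_iff not_le)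
    qed
    then have T: "finite T" "T \<noteq> {}" using i finite_subset by (auto simp: T_def)
    have "Max (h ` T) \<in> h ` T" using T by (intro Max_in) auto
    then obtain k where k: "k \<in> T" "h k = Max (h ` T)" by auto
    have "h j \<le> h k" if "j \<notin> A" for j
    proof (cases "h i \<le> h j")
      case True
      then have "j \<in> T" using that by (simp add: T_def)
      then show ?thesis using T k(2) by simp
    next
      case False
      then show ?thesis using k(1) by (simp add: T_def)
    qed
    then show ?thesis using k(1) by (auto simp: T_def)
  next
    case False
    obtain k where "k \<notin> A" using ex_new_if_finite[OF infinite_UNIV_nat A] by blast
    then show ?thesis using False h0 by (meson not_le order_trans)
  qed
  define F where "F A = (SOME k. k \<notin> A \<and> (\<forall>j. j \<notin> A \<longrightarrow> h j \<le> h k))" for A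
  have F: "F A \<notin> A" "\<And>j. j \<notin> A \<Longrightarrow> h j \<le> h (F A)" if "finite A" for A
    using someI_ex[OF ex[OF that]] unfolding F_def by auto
  define S where "S = rec_nat {} (\<lambda>_ A. insert (F A) A)"
  define s where "s n = F (S n)" for n
  have S: "S n = s ` {..<n}" for n
    by (induction n) (simp_all add: S_def s_def lessThan_Suc)
  have new: "s n \<notin> s ` {..<n}" and top: "\<And>j. j \<notin> s ` {..<n} \<Longrightarrow> h j \<le> h (s n)" for n
    using F[of "S n", folded s_def] by (simp_all add: S)
  have inj: "inj s"
  proof (rule injI)
    fix m n assume eq: "s m = s n"
    show "m = n" using new[of m] new[of n] eq by (cases m n rule: linorder_cases) (metis imageI lessThan_iff)+
  qed
  have dec: "decseq (\<lambda>n. h (s n))"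
  proof (rule decseq_SucI)
    fix n
    have "s (Suc n) \<notin> s ` {..<n}" using new[of "Suc n"] by auto
    then show "h (s (Suc n)) \<le> h (s n)" by (rule top)
  qed
  \<comment> \<open>A skipped index was a candidate at every stage, so its value lies below all h(s
    n), and these tend to 0.\<close>
  have "h k = 0" if k: "k \<notin> range s" for k
  proof (rule antisym[OF _ h0])
    show "h k \<le> 0"
      using k by (intro LIMSEQ_le_const[OF LIMSEQ_inj[OF inj h]] exI[of _ 0] allI impI top) auto
  qed
  then show ?thesis using inj dec that by blast
qed

section \<open>Properties of maps that agree with a Choquet trace on \<open>Kpos\<close>\<close>

context
  fixes \<phi> :: "('a::complex_hilbert_space \<Rightarrow>\<^sub>L 'a) \<Rightarrow> ennreal" and \<alpha> :: "nat \<Rightarrow> real"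
  assumes inf: "infinite_dimensional TYPE('a)"
    and \<alpha>: "mono \<alpha>" "\<alpha> 0 = 0"
    and \<phi>: "\<And>a. a \<in> Kpos \<Longrightarrow> \<phi> a = choquet_trace \<alpha> a"
begin

lemma increment_nonneg: "0 \<le> \<alpha> (Suc n) - \<alpha> n"
  using \<alpha>(1) by (simp add: mono_def)

lemma choquet_diag:
  assumes "orthonormal e" "l \<longlonglongrightarrow> 0" "decseq l"
  shows "\<phi> (diag e l) = (\<Sum>n. ennreal (l n * (\<alpha> (Suc n) - \<alpha> n)))"
  using assms \<phi>[OF diag_in_Kpos[OF assms(1,2)]] choquet_trace_diag[OF assms \<alpha>] decseq_LIMSEQ_0_nonneg[OF assms(3,2)]
  by simp

lemma choquet_unitarily_invariant: "unitarily_invariant \<phi>"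
  unfolding unitarily_invariant_def
proof (intro ballI allI impI)
  fix a u :: "'a \<Rightarrow>\<^sub>L 'a" assume a: "a \<in> Kpos" and u: "unitary u"
  obtain e l where e: "orthonormal e" "l \<longlonglongrightarrow> 0" "decseq l" "a = diag e l" using Kpos_diagE[OF inf a] .
  show "\<phi> (u o\<^sub>L a o\<^sub>L adj u) = \<phi> a"
    unfolding e(4) unitary_conjugate_diag[OF e(1,2) u]
    by (simp only: choquet_diag[OF e(1-3)] choquet_diag[OF orthonormal_unitary[OF e(1) u] e(2,3)])
qed

lemma choquet_monotone: "op_monotone \<phi>"
  unfolding op_monotone_def
proof (intro ballI impI)
  fix a b :: "'a \<Rightarrow>\<^sub>L 'a" assume a: "a \<in> Kpos" and b: "b \<in> Kpos" and ab: "positive (b - a)"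
  obtain e l where e: "orthonormal e" "l \<longlonglongrightarrow> 0" "decseq l" "a = diag e l" using Kpos_diagE[OF inf a] .
  obtain f m where f: "orthonormal f" "m \<longlonglongrightarrow> 0" "decseq m" "b = diag f m" using Kpos_diagE[OF inf b] .
  have "l n \<le> m n" for n
    using eigenvalue_comparison[OF e(1-3) f(1-3), of 0 n] positive_Re_Im(1)[OF ab]
    by (simp add: blinfun.diff_left cinner_simps e(4) f(4))
  then show "\<phi> a \<le> \<phi> b"
    unfolding e(4) f(4) choquet_diag[OF e(1-3)] choquet_diag[OF f(1-3)]
    by (intro suminf_le summableI ennreal_leI mult_right_mono increment_nonneg)
qed

lemma choquet_homogeneous: "positively_homogeneous \<phi>"
  unfolding positively_homogeneous_def
proof (intro ballI allI impI)
  fix a :: "'a \<Rightarrow>\<^sub>L 'a" and k :: real assume a: "a \<in> Kpos" and k: "0 \<le> k"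
  obtain e l where e: "orthonormal e" "l \<longlonglongrightarrow> 0" "decseq l" "a = diag e l" using Kpos_diagE[OF inf a] .
  have kl: "(\<lambda>n. k * l n) \<longlonglongrightarrow> 0" using tendsto_mult[OF tendsto_const[of k] e(2)] by simp
  have "decseq (\<lambda>n. k * l n)" using e(3) k by (auto simp: decseq_def intro: mult_left_mono)
  then have "\<phi> (k *\<^sub>R a) = (\<Sum>n. ennreal k * ennreal (l n * (\<alpha> (Suc n) - \<alpha> n)))"
    unfolding e(4) diag_scaleR[OF e(1,2), symmetric] choquet_diag[OF e(1) kl]
    using k decseq_LIMSEQ_0_nonneg[OF e(3,2)] increment_nonneg
    by (simp add: ennreal_mult'[symmetric] mult.assoc choquet_diag[OF e(1) kl])
  then show "\<phi> (k *\<^sub>R a) = ennreal k * \<phi> a" by (simp add: e(4) choquet_diag[OF e(1-3)])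
qed

lemma choquet_comonotonic_additive: "comonotonic_additive \<phi>"
  unfolding comonotonic_additive_def
proof (intro ballI impI)
  fix a :: "'a \<Rightarrow>\<^sub>L 'a" and f g
  assume a: "a \<in> Kpos" and f: "f \<in> spec_funs a" and g: "g \<in> spec_funs a"
    and com: "comonotonic_on (real_spectrum a) f g"
  obtain e l where e: "orthonormal e" "l \<longlonglongrightarrow> 0" "decseq l" "a = diag e l" using Kpos_diagE[OF inf a] .
  have sp: "l n \<in> real_spectrum a" for n by (simp add: e(4) real_spectrum_diag[OF e(1,2)])
  have f0: "0 \<le> f (l n)" and g0: "0 \<le> g (l n)" for n using f g sp by (auto simp: spec_funs_def)
  have cf: "continuous_on (real_spectrum (diag e l)) f" "f 0 = 0"
    and cg: "continuous_on (real_spectrum (diag e l)) g" "g 0 = 0"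
    using f g by (auto simp: spec_funs_def e(4))
  note fl = LIMSEQ_spectrum[OF e(1,2) cf] and gl = LIMSEQ_spectrum[OF e(1,2) cg]
  define h where "h n = f (l n) + g (l n)" for n
  have h0: "0 \<le> h n" for n using f0[of n] g0[of n] by (simp add: h_def)
  have hl: "h \<longlonglongrightarrow> 0" using tendsto_add[OF fl gl] by (simp add: h_def[abs_def])
  obtain s where s: "inj s" "decseq (\<lambda>n. h (s n))" "\<And>k. k \<notin> range s \<Longrightarrow> h k = 0"
    using sorted_enumeration[OF h0 hl] by blast
  \<comment> \<open>Nonnegativity makes both functions vanish where their sum does, so indices
    skipped by \<open>s\<close> contribute to neither operator.\<close>
  have out: "f (l k) = 0" "g (l k) = 0" if "k \<notin> range s" for k
    using s(3)[OF that] f0[of k] g0[of k] by (auto simp: h_def add_nonneg_eq_0_iff)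
  \<comment> \<open>Comonotonicity makes \<open>f\<close> and \<open>g\<close> nondecreasing functions of \<open>f + g\<close>.\<close>
  have le: "f (l j) \<le> f (l i) \<and> g (l j) \<le> g (l i)" if "h j \<le> h i" for i j
  proof -
    have "0 \<le> (f (l j) - f (l i)) * (g (l j) - g (l i))" using com sp by (simp add: comonotonic_on_def)
    then show ?thesis using that by (auto simp: h_def zero_le_mult_iff)
  qed
  define F G where "F i = f (l (s i))" and "G i = g (l (s i))" for i
  have dF: "decseq F" and dG: "decseq G" using s(2) le by (auto simp: decseq_def F_def G_def)
  have F0: "F \<longlonglongrightarrow> 0" and G0: "G \<longlonglongrightarrow> 0"
    using LIMSEQ_inj[OF s(1) fl] LIMSEQ_inj[OF s(1) gl] by (simp_all add: F_def[abs_def] G_def[abs_def])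
  have FG: "decseq (\<lambda>i. F i + G i)" "(\<lambda>i. F i + G i) \<longlonglongrightarrow> 0"
    using dF dG tendsto_add[OF F0 G0] by (auto simp: decseq_def intro: add_mono)
  let ?e = "\<lambda>i. e (s i)"
  have e': "orthonormal ?e" using e(1) s(1) by (simp add: orthonormal_on_def inj_eq)
  have fa: "fun_calc f a = diag ?e F"
    unfolding e(4) fun_calc_diag[OF e(1,2) cf] F_def[abs_def] by (rule diag_reindex[OF e(1) fl s(1) out(1), symmetric])
  have ga: "fun_calc g a = diag ?e G"
    unfolding e(4) fun_calc_diag[OF e(1,2) cg] G_def[abs_def] by (rule diag_reindex[OF e(1) gl s(1) out(2), symmetric])
  have "\<phi> (fun_calc f a + fun_calc g a) = (\<Sum>n. ennreal ((F n + G n) * (\<alpha> (Suc n) - \<alpha> n)))"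
    unfolding fa ga diag_add[OF e' F0 G0, symmetric] by (rule choquet_diag[OF e' FG(2,1)])
  also have "\<dots> = (\<Sum>n. ennreal (F n * (\<alpha> (Suc n) - \<alpha> n)) + ennreal (G n * (\<alpha> (Suc n) - \<alpha> n)))"
    using increment_nonneg f0 g0 by (simp add: distrib_right F_def G_def)
  also have "\<dots> = \<phi> (fun_calc f a) + \<phi> (fun_calc g a)"
    unfolding fa ga choquet_diag[OF e' F0 dF] choquet_diag[OF e' G0 dG]
    by (rule suminf_add[symmetric]) (rule summableI)+
  finally show "\<phi> (fun_calc f a + fun_calc g a) = \<phi> (fun_calc f a) + \<phi> (fun_calc g a)" .
qed

text \<open>Both clauses of lower semicontinuity follow from this topological form. A finite partial
  sum already exceeds \<open>y\<close>, and each eigenvalue drops by at most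
  \<open>norm (x - a)\<close>, by the comparison with that error.\<close>

lemma choquet_locally_greater:
  assumes a: "a \<in> Kpos" and y: "y < \<phi> a"
  shows "\<exists>\<delta>::real>0. \<forall>x\<in>Kpos. norm (x - a) < \<delta> \<longrightarrow> y < \<phi> x"
proof -
  obtain e l where e: "orthonormal e" "l \<longlonglongrightarrow> 0" "decseq l" "a = diag e l" using Kpos_diagE[OF inf a] .
  let ?c = "\<lambda>n. \<alpha> (Suc n) - \<alpha> n"
  have "y < (SUP N. \<Sum>n<N. ennreal (l n * ?c n))"
    using y unfolding e(4) choquet_diag[OF e(1-3)] by (subst (asm) suminf_eq_SUP) (auto intro: summableI)
  then obtain N where N: "y < (\<Sum>n<N. ennreal (l n * ?c n))" by (auto simp: less_SUP_iff)
  define S where "S = (\<Sum>n<N. l n * ?c n)"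
  have "(\<Sum>n<N. ennreal (l n * ?c n)) = ennreal S"
    unfolding S_def using decseq_LIMSEQ_0_nonneg[OF e(3,2)] increment_nonneg by (intro sum_ennreal) simp
  then have yS: "y < ennreal S" using N by simp
  then obtain r where r: "0 \<le> r" "y = ennreal r" by (cases y) auto
  have rS: "r < S" using yS r by (simp add: ennreal_less_iff)
  define C where "C = (\<Sum>n<N. ?c n)"
  have C: "0 \<le> C" unfolding C_def by (intro sum_nonneg increment_nonneg)
  \<comment> \<open>The partial sum falls by at most \<open>C\<close> times the distance; adding 1
    to \<open>C\<close> keeps the radius defined when all increments vanish.\<close>
  have "y < \<phi> x" if x: "x \<in> Kpos" "norm (x - a) < (S - r) / (C + 1)" for x
  proof -
    obtain f m where f: "orthonormal f" "m \<longlonglongrightarrow> 0" "decseq m" "x = diag f m" using Kpos_diagE[OF inf x(1)] .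
    define d where "d = norm (x - a)"
    have lm: "l n \<le> m n + d" for n
    proof (rule eigenvalue_comparison[OF e(1-3) f(1-3)])
      fix z
      have "Re (cinner (blinfun_apply (a - x) z) z) \<le> norm (blinfun_apply (a - x) z) * norm z"
        using complex_Re_le_cmod cinner_cauchy_schwarz order_trans by blast
      also have "\<dots> \<le> (norm (a - x) * norm z) * norm z" by (intro mult_right_mono norm_blinfun) simp
      finally show "Re (cinner (blinfun_apply (diag e l) z) z) \<le> Re (cinner (blinfun_apply (diag f m) z) z) + d * (norm z)\<^sup>2"
        by (simp add: blinfun.diff_left cinner_simps d_def norm_minus_commute power2_eq_square mult.assoc e(4) f(4))
    qed
    have m0: "0 \<le> m n" for n by (rule decseq_LIMSEQ_0_nonneg[OF f(3,2)])
    have "d * C \<le> d * (C + 1)" by (intro mult_left_mono) (simp_all add: d_def)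
    also have "\<dots> < S - r" using x(2) C by (simp add: d_def pos_less_divide_eq)
    finally have "r < S - d * C" by simp
    \<comment> \<open>Here \<open>l n - d\<close> may be negative, so the estimate is carried out in
      the reals before returning to \<open>ennreal\<close>.\<close>
    also have "\<dots> = (\<Sum>n<N. (l n - d) * ?c n)"
      by (simp only: S_def C_def sum_distrib_left sum_subtractf[symmetric] left_diff_distrib)
    also have "\<dots> \<le> (\<Sum>n<N. m n * ?c n)"
    proof (intro sum_mono mult_right_mono increment_nonneg)
      show "l n - d \<le> m n" for n using lm[of n] by simp
    qed
    finally have "y < ennreal (\<Sum>n<N. m n * ?c n)" using r by (simp add: ennreal_less_iff)
    also have "\<dots> = (\<Sum>n<N. ennreal (m n * ?c n))" using m0 increment_nonneg by (intro sum_ennreal[symmetric]) simp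
    also have "\<dots> \<le> \<phi> x"
      unfolding f(4) choquet_diag[OF f(1-3)] by (intro sum_le_suminf summableI) auto
    finally show ?thesis .
  qed
  moreover have "0 < (S - r) / (C + 1)" using rS C by simp
  ultimately show ?thesis by blast
qed

lemma choquet_lower_semicontinuous: "lower_semicontinuous \<phi>"
  unfolding lower_semicontinuous_def
proof (intro ballI conjI impI allI)
  fix a :: "'a \<Rightarrow>\<^sub>L 'a" and \<epsilon> :: real
  assume a: "a \<in> Kpos" and fin: "\<phi> a < \<infinity>" and \<epsilon>: "0 < \<epsilon>"
  then obtain r where r: "0 \<le> r" "\<phi> a = ennreal r" by (cases "\<phi> a") auto
  show "\<exists>\<delta>>0. \<forall>x\<in>Kpos. norm (x - a) < \<delta> \<longrightarrow> \<phi> a < \<phi> x + ennreal \<epsilon>"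
  \<comment> \<open>For \<open>r < \<epsilon>\<close> the number r - \<epsilon> is negative and
    \<open>ennreal\<close> would truncate it to 0, but then the claim holds for every
    \<open>x\<close>.\<close>
  proof (cases "r < \<epsilon>")
    case True
    then have "\<phi> a < ennreal \<epsilon>" using r by (simp add: ennreal_less_iff)
    also have "ennreal \<epsilon> \<le> \<phi> x + ennreal \<epsilon>" for x by simp
    finally have "\<phi> a < \<phi> x + ennreal \<epsilon>" for x .
    then show ?thesis by (intro exI[of _ 1]) simp
  next
    case False
    have "ennreal (r - \<epsilon>) < \<phi> a" using r False \<epsilon> by (simp add: ennreal_less_iff)
    then obtain \<delta> where \<delta>: "\<delta> > 0" "\<And>x. x \<in> Kpos \<Longrightarrow> norm (x - a) < \<delta> \<Longrightarrow> ennreal (r - \<epsilon>) < \<phi> x"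
      using choquet_locally_greater[OF a] by blast
    have "\<phi> a < \<phi> x + ennreal \<epsilon>" if "x \<in> Kpos" "norm (x - a) < \<delta>" for x
    proof -
      have "\<phi> a = ennreal \<epsilon> + ennreal (r - \<epsilon>)"
        using False \<epsilon> r by (simp add: ennreal_plus[symmetric] del: ennreal_plus)
      also have "\<dots> < ennreal \<epsilon> + \<phi> x" using \<delta>(2)[OF that] by (simp add: ennreal_add_left_cancel_less)
      finally show ?thesis by (simp add: add.commute)
    qed
    then show ?thesis using \<delta>(1) by blast
  qed
next
  fix a :: "'a \<Rightarrow>\<^sub>L 'a" and M :: real
  assume a: "a \<in> Kpos" and "\<phi> a = \<infinity>" "0 < M"
  then show "\<exists>\<delta>>0. \<forall>x\<in>Kpos. norm (x - a) < \<delta> \<longrightarrow> ennreal M < \<phi> x"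
    by (intro choquet_locally_greater[OF a]) simp
qed

lemma choquet_finite_rank:
  assumes a: "a \<in> Fpos"
  shows "\<phi> a < \<infinity>"
proof -
  have aK: "a \<in> Kpos" using a Fpos_subset_Kpos by blast
  obtain e l where e: "orthonormal e" "l \<longlonglongrightarrow> 0" "decseq l" "a = diag e l" using Kpos_diagE[OF inf aK] .
  obtain B where B: "finite B" "range (blinfun_apply a) \<subseteq> cvec.span B"
    using a by (auto simp: Fpos_def finite_rank_def)
  \<comment> \<open>Otherwise every \<open>e n\<close> would be the image of a multiple of itself,
    hence in the span of \<open>B\<close>, and \<open>card B + 1\<close> orthonormal vectors would
    be linearly dependent. A single zero is enough, as \<open>l\<close> decreases.\<close>
  have "\<exists>N. l N = 0"
  proof (rule ccontr)
    assume nz: "\<nexists>N. l N = 0"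
    have "e n \<in> cvec.span B" for n
    proof -
      have "blinfun_apply a ((1 / l n) *\<^sub>R e n) = e n"
        using nz by (simp add: e(4) blinfun.scaleR_right diag_eigenvector[OF e(1,2)])
      then show ?thesis using B(2) by (metis rangeI subsetD)
    qed
    then have "\<exists>c. e n = (\<Sum>b\<in>B. c b *\<^sub>C b)" for n unfolding cvec.span_finite[OF B(1)] by auto
    then obtain A where A: "\<And>n. e n = (\<Sum>b\<in>B. A n b *\<^sub>C b)" by metis
    obtain d where d: "\<exists>i\<in>{..card B}. d i \<noteq> 0" "\<forall>b\<in>B. (\<Sum>i\<le>card B. d i * A i b) = 0"
      using exists_null_vector[of B "{..card B}" A] B(1) by auto
    have "(\<Sum>i\<le>card B. d i *\<^sub>C e i) = (\<Sum>i\<le>card B. \<Sum>b\<in>B. (d i * A i b) *\<^sub>C b)"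
      by (subst A) (simp add: scaleC_sum_right)
    also have "\<dots> = (\<Sum>b\<in>B. (\<Sum>i\<le>card B. d i * A i b) *\<^sub>C b)"
      by (subst sum.swap) (simp add: cvec.scale_sum_left)
    also have "\<dots> = 0" using d(2) by simp
    finally have z: "(\<Sum>i\<le>card B. d i *\<^sub>C e i) = 0" .
    have "d i = 0" if "i \<le> card B" for i
      using cinner_orthonormal_sum[OF orthonormal_on_subset[OF e(1)], of "{..card B}" i d] that by (simp add: z)
    then show False using d(1) by auto
  qed
  then obtain N where "l N = 0" by blast
  then have lz: "l n = 0" if "n \<ge> N" for n
    using decseqD[OF e(3) that] decseq_LIMSEQ_0_nonneg[OF e(3,2), of n] by simp
  have "\<phi> a = (\<Sum>n<N. ennreal (l n * (\<alpha> (Suc n) - \<alpha> n)))"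
    unfolding e(4) choquet_diag[OF e(1-3)] by (rule suminf_finite) (use lz in \<open>auto simp: not_less\<close>)
  then show ?thesis by (simp add: sum_ennreal less_top[symmetric])
qed

end

subsection \<open>Recovering the weight from the map\<close>

lemma positive_proj: "positive (proj v)"
proof (rule positiveI[OF bop_proj])
  fix x
  have "cinner (blinfun_apply (proj v) x) x = of_real ((cmod (cinner x v))\<^sup>2)"
    by (simp only: proj_apply cinner_scaleC_left complex_norm_square cnj_cinner)
  then show "0 \<le> Re (cinner (blinfun_apply (proj v) x) x)" "Im (cinner (blinfun_apply (proj v) x) x) = 0"
    by simp_all
qed

lemma positive_sum:
  assumes "\<And>i. i \<in> F \<Longrightarrow> positive (f i)"
  shows "positive (\<Sum>i\<in>F. f i)"
proof (rule positiveI)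
  show "(\<Sum>i\<in>F. f i) \<in> bop" using assms by (intro bop_sum) (auto simp: positive_def)
qed (auto simp: blinfun.sum_left cinner_sum_left positive_Re_Im[OF assms] intro!: sum_nonneg)

lemma sum_proj_in_Fpos:
  assumes "finite F"
  shows "(\<Sum>i\<in>F. proj (e i)) \<in> Fpos"
proof -
  have "range (blinfun_apply (\<Sum>i\<in>F. proj (e i))) \<subseteq> cvec.span (e ` F)"
    by (auto simp: blinfun.sum_left proj_apply intro!: cvec.span_sum cvec.span_scale intro: cvec.span_base)
  then have "finite_rank (\<Sum>i\<in>F. proj (e i))"
    unfolding finite_rank_def using assms by (intro conjI bop_sum bop_proj exI[of _ "e ` F"]) auto
  then show ?thesis by (simp add: Fpos_def positive_sum positive_proj)
qed

text \<open>The reflection exchanging the two families is unitary.\<close>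

lemma unitarily_invariant_swap:
  assumes \<phi>: "unitarily_invariant \<phi>" and F: "finite F"
    and e: "orthonormal_on F e" and f: "orthonormal_on F f" and ef: "\<And>i j. i \<in> F \<Longrightarrow> j \<in> F \<Longrightarrow> cinner (e i) (f j) = 0"
  shows "\<phi> (\<Sum>i\<in>F. proj (e i)) = \<phi> (\<Sum>i\<in>F. proj (f i))"
proof -
  define w where "w i = e i - f i" for i
  define P where "P = (\<Sum>i\<in>F. proj (w i))"
  \<comment> \<open>Since the \<open>w i\<close> are orthogonal of norm sqrt 2, \<open>P\<close> is
    twice the projection onto their span. So \<open>u\<close> changes the sign of e(i) - f(i) and
    fixes e(i) + f(i).\<close>
  define u where "u = id_blinfun - P"
  have fe: "cinner (f i) (e j) = 0" if "i \<in> F" "j \<in> F" for i j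
    using ef[OF that(2,1)] cnj_cinner[of "e j" "f i"] by simp
  have ww: "cinner (w i) (w j) = (if i = j then 2 else 0)" if "i \<in> F" "j \<in> F" for i j
    using that orthonormal_onD[OF e] orthonormal_onD[OF f] ef fe by (simp add: w_def cinner_simps)
  have ew: "cinner (e i) (w j) = (if i = j then 1 else 0)" if "i \<in> F" "j \<in> F" for i j
    using that orthonormal_onD[OF e] ef by (simp add: w_def cinner_simps)
  have Pa: "blinfun_apply P x = (\<Sum>i\<in>F. cinner x (w i) *\<^sub>C w i)" for x
    by (simp add: P_def blinfun.sum_left proj_apply)
  have Pw: "blinfun_apply P (w i) = 2 *\<^sub>R w i" if "i \<in> F" for i
  proof -
    have "(\<Sum>j\<in>F. cinner (w i) (w j) *\<^sub>C w j) = (\<Sum>j\<in>F. if j = i then 2 *\<^sub>C w j else 0)"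
      using that by (intro sum.cong) (auto simp: ww)
    also have "\<dots> = 2 *\<^sub>R w i" using F that scaleC_of_real[of 2 "w i"] by simp
    finally show ?thesis by (simp only: Pa)
  qed
  have Pb: "P \<in> bop" unfolding P_def by (intro bop_sum bop_proj)
  have PP: "blinfun_apply P (blinfun_apply P x) = 2 *\<^sub>R blinfun_apply P x" for x
    by (simp add: Pa[of x] blinfun.sum_right bopD[OF Pb] Pw scaleC_scaleR_commute scaleR_sum_right)
  have Psa: "cinner (blinfun_apply P x) y = cinner x (blinfun_apply P y)" for x y
    unfolding P_def by (intro positive_selfadjoint positive_sum positive_proj)
  have ub: "u \<in> bop" unfolding u_def by (intro bop_diff bop_id Pb)
  have adju: "adj u = u" by (rule adj_eqI[OF ub]) (simp add: u_def blinfun.diff_left cinner_simps Psa)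
  have "u o\<^sub>L u = id_blinfun"
    by (rule blinfun_eqI) (simp add: u_def blinfun.diff_left blinfun.diff_right PP scaleR_2)
  then have uu: "unitary u" by (simp add: unitary_def ub adju)
  have ue: "blinfun_apply u (e i) = f i" if "i \<in> F" for i
  proof -
    have "(\<Sum>j\<in>F. cinner (e i) (w j) *\<^sub>C w j) = (\<Sum>j\<in>F. if j = i then w j else 0)"
      using that by (intro sum.cong) (auto simp: ew)
    then show ?thesis using F that by (simp add: u_def blinfun.diff_left Pa w_def)
  qed
  have "u o\<^sub>L (\<Sum>i\<in>F. proj (e i)) o\<^sub>L adj u = (\<Sum>i\<in>F. u o\<^sub>L proj (e i) o\<^sub>L adj u)"
    by (intro linear_sum bounded_linear.linear bounded_linear_conjugate)
  also have "\<dots> = (\<Sum>i\<in>F. proj (f i))"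
    by (intro sum.cong) (simp_all add: unitary_conjugate_proj[OF uu] ue)
  finally have "u o\<^sub>L (\<Sum>i\<in>F. proj (e i)) o\<^sub>L adj u = (\<Sum>i\<in>F. proj (f i))" .
  moreover have "(\<Sum>i\<in>F. proj (e i)) \<in> Kpos" using sum_proj_in_Fpos[OF F] Fpos_subset_Kpos by blast
  ultimately show ?thesis using \<phi> uu unfolding unitarily_invariant_def by metis
qed

lemma orthonormal_family_orthogonal:
  fixes B :: "'a::complex_hilbert_space set"
  assumes inf: "infinite_dimensional TYPE('a)" and B: "finite B"
  shows "\<exists>g :: nat \<Rightarrow> 'a. orthonormal_on {..<n} g \<and> (\<forall>i<n. \<forall>b\<in>B. cinner (g i) b = 0)"
proof (induction n)
  case 0
  show ?case by (simp add: orthonormal_on_def)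
next
  case (Suc n)
  then obtain g :: "nat \<Rightarrow> 'a" where g: "orthonormal_on {..<n} g" "\<And>i b. i < n \<Longrightarrow> b \<in> B \<Longrightarrow> cinner (g i) b = 0" by blast
  obtain v where v: "norm v = 1" "\<And>b. b \<in> B \<union> g ` {..<n} \<Longrightarrow> cinner v b = 0"
    using unit_vector_orthogonal[OF inf, of "B \<union> g ` {..<n}"] B by blast
  have gv: "cinner v (g i) = 0" "cinner (g i) v = 0" if "i < n" for i
    using v(2)[of "g i"] that cnj_cinner[of v "g i"] by auto
  have "orthonormal_on {..<Suc n} (g(n := v))"
    using g(1) gv v(1) by (auto simp: orthonormal_on_def norm_eq_1_iff_cinner less_Suc_eq)
  moreover have "\<forall>i<Suc n. \<forall>b\<in>B. cinner ((g(n := v)) i) b = 0"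
    using g(2) v(2) by (auto simp: less_Suc_eq)
  ultimately show ?case by blast
qed

text \<open>Two given families may overlap, so the reflection does not apply to them directly. A
  third family orthogonal to both links them by two reflections, and no partial isometry has to be
  extended to a unitary.\<close>

lemma unitarily_invariant_projections:
  fixes e f :: "nat \<Rightarrow> 'a::complex_hilbert_space"
  assumes inf: "infinite_dimensional TYPE('a)" and \<phi>: "unitarily_invariant \<phi>"
    and e: "orthonormal e" and f: "orthonormal f"
  shows "\<phi> (\<Sum>i<n. proj (e i)) = \<phi> (\<Sum>i<n. proj (f i))"
proof -
  obtain g where g: "orthonormal_on {..<n} g" "\<And>i b. i < n \<Longrightarrow> b \<in> e ` {..<n} \<union> f ` {..<n} \<Longrightarrow> cinner (g i) b = 0"
    using orthonormal_family_orthogonal[OF inf, of "e ` {..<n} \<union> f ` {..<n}" n] by blast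
  have "\<phi> (\<Sum>i<n. proj (g i)) = \<phi> (\<Sum>i<n. proj (h i))" if "orthonormal h" "h = e \<or> h = f" for h
    by (rule unitarily_invariant_swap[OF \<phi> _ g(1) orthonormal_on_subset[OF that(1)]]) (use g(2) that(2) in auto)
  then show ?thesis using e f by metis
qed

section \<open>Approximation from below and the layers of a diagonal operator\<close>

lemma lower_semicontinuousD:
  fixes a :: "'a::complex_hilbert_space \<Rightarrow>\<^sub>L 'a" and \<epsilon> M :: real
  assumes "lower_semicontinuous \<phi>" "a \<in> Kpos"
  shows "\<phi> a < \<infinity> \<Longrightarrow> 0 < \<epsilon> \<Longrightarrow> \<exists>\<delta>::real>0. \<forall>x\<in>Kpos. norm (x - a) < \<delta> \<longrightarrow> \<phi> a < \<phi> x + ennreal \<epsilon>"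
    and "\<phi> a = \<infinity> \<Longrightarrow> 0 < M \<Longrightarrow> \<exists>\<delta>::real>0. \<forall>x\<in>Kpos. norm (x - a) < \<delta> \<longrightarrow> ennreal M < \<phi> x"
  using bspec[OF assms(1)[unfolded lower_semicontinuous_def] assms(2)] by simp_all

text \<open>Monotonicity bounds the supremum by \<phi>(a), and lower semicontinuity gives the
  reverse inequality; infinite \<phi>(a) is handled by arbitrarily large bounds M.\<close>

lemma monotone_lower_semicontinuous_limit:
  assumes mon: "op_monotone \<phi>" and lsc: "lower_semicontinuous \<phi>"
    and a: "a \<in> Kpos" and A: "\<And>k::nat. A k \<in> Kpos" "\<And>k. positive (a - A k)" "A \<longlonglongrightarrow> a"
  shows "\<phi> a = (SUP k. \<phi> (A k))"
proof (rule antisym)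
  show "(SUP k. \<phi> (A k)) \<le> \<phi> a"
    using mon a A(1,2) unfolding op_monotone_def by (intro SUP_least) blast
  have close: "\<exists>k. norm (A k - a) < \<delta>" if "\<delta> > 0" for \<delta>
    using LIMSEQ_D[OF A(3) that] by blast
  show "\<phi> a \<le> (SUP k. \<phi> (A k))"
  proof (cases "\<phi> a = \<infinity>")
    case True
    have "ennreal M < (SUP k. \<phi> (A k))" if M: "M > 0" for M :: real
    proof -
      obtain \<delta> :: real where \<delta>: "\<delta> > 0" "\<And>x. x \<in> Kpos \<Longrightarrow> norm (x - a) < \<delta> \<Longrightarrow> ennreal M < \<phi> x"
        using lower_semicontinuousD(2)[OF lsc a True M] by blast
      then obtain k where "norm (A k - a) < \<delta>" using close by blast
      then have "ennreal M < \<phi> (A k)" by (intro \<delta>(2) A(1))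
      also have "\<dots> \<le> (SUP k. \<phi> (A k))" by (rule SUP_upper) simp
      finally show ?thesis .
    qed
    note big = this
    have "(SUP k. \<phi> (A k)) = \<infinity>"
    proof (cases "SUP k. \<phi> (A k)")
      case (real r)
      then show ?thesis using big[of "r + 1"] by (simp add: ennreal_less_iff)
    qed simp
    then show ?thesis by (simp only: infinity_ennreal_def top_greatest)
  next
    case False
    show ?thesis
    proof (rule ennreal_le_epsilon)
      fix \<epsilon> :: real assume "0 < \<epsilon>"
      then obtain \<delta> :: real where \<delta>: "\<delta> > 0" "\<And>x. x \<in> Kpos \<Longrightarrow> norm (x - a) < \<delta> \<Longrightarrow> \<phi> a < \<phi> x + ennreal \<epsilon>"
        using lower_semicontinuousD(1)[OF lsc a, of \<epsilon>] False by (auto simp: less_top)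
      then obtain k where "norm (A k - a) < \<delta>" using close by blast
      then have "\<phi> a < \<phi> (A k) + ennreal \<epsilon>" by (intro \<delta>(2) A(1))
      also have "\<dots> \<le> (SUP k. \<phi> (A k)) + ennreal \<epsilon>" by (intro add_right_mono SUP_upper) simp
      finally show "\<phi> a \<le> (SUP k. \<phi> (A k)) + ennreal \<epsilon>" by simp
    qed
  qed
qed

lemma zero_in_Kpos: "0 \<in> Kpos"
  using sum_proj_in_Fpos[of "{}"] Fpos_subset_Kpos by auto

text \<open>
  With \<open>f\<^sub>k t = (t - l\<^sub>k)\<^sup>+\<close> the increments \<open>f\<^bsub>k+1\<^esub> - f\<^sub>k\<close> are monotone and turn \<open>a\<close> into multiples
  of spectral projections, while \<open>f\<^sub>k(a)\<close> increases to \<open>a\<close>.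
\<close>

lemma monotone_additive_eq_choquet_trace:
  fixes \<phi> :: "('a::complex_hilbert_space \<Rightarrow>\<^sub>L 'a) \<Rightarrow> ennreal"
  assumes add: "monotonic_increasing_additive \<phi>" and mon: "op_monotone \<phi>"
    and hom: "positively_homogeneous \<phi>" and lsc: "lower_semicontinuous \<phi>"
    and e: "orthonormal e" "l \<longlonglongrightarrow> 0" "decseq l"
    and \<alpha>: "\<And>n. \<phi> (\<Sum>i<n. proj (e i)) = ennreal (\<alpha> n)" "\<And>n. 0 \<le> \<alpha> n"
  shows "\<phi> (diag e l) = choquet_trace \<alpha> (diag e l)"
proof -
  let ?a = "diag e l"
  have l0: "0 \<le> l n" for n by (rule decseq_LIMSEQ_0_nonneg[OF e(3,2)])
  have dl: "l (Suc k) \<le> l k" for k using e(3) by (simp add: decseq_Suc_iff)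
  have aK: "?a \<in> Kpos" by (rule diag_in_Kpos[OF e(1,2) l0])
  define F where "F k t = max (t - l k) 0" for k t
  \<comment> \<open>This is the increment of \<open>F\<close>, written with \<open>min\<close> and
    \<open>max\<close> so that its monotonicity and nonnegativity are apparent.\<close>
  define G where "G k t = min (max (t - l (Suc k)) 0) (l k - l (Suc k))" for k t
  have FS: "F k \<in> spec_funs ?a" "G k \<in> spec_funs ?a" for k
    using l0[of k] l0[of "Suc k"] dl[of k] by (auto simp: spec_funs_def F_def G_def intro!: continuous_intros)
  have FG: "F (Suc k) t = F k t + G k t" for k t
    using dl[of k] by (auto simp: F_def G_def max_def min_def)
  have cF: "continuous_on (real_spectrum ?a) (F k)" "F k 0 = 0"
    and cG: "continuous_on (real_spectrum ?a) (G k)" "G k 0 = 0" for k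
    using FS by (simp_all add: spec_funs_def)
  note Fl = LIMSEQ_spectrum[OF e(1,2) cF] and Gl = LIMSEQ_spectrum[OF e(1,2) cG]
  note Fc = fun_calc_diag[OF e(1,2) cF] and Gc = fun_calc_diag[OF e(1,2) cG]
  define A where "A k = diag e (\<lambda>n. F k (l n))" for k
  have G: "diag e (\<lambda>n. G k (l n)) = (l k - l (Suc k)) *\<^sub>R (\<Sum>i<Suc k. proj (e i))" for k
  proof -
    \<comment> \<open>Entries up to \<open>k\<close> lie above the layer and get its full height,
      later ones lie below it and get 0. For equal neighbours the height is 0, so ties are
      consistent.\<close>
    have Gv: "G k (l n) = (if n < Suc k then l k - l (Suc k) else 0)" for n
      using decseqD[OF e(3), of n k] decseqD[OF e(3), of "Suc k" n] dl[of k]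
      by (auto simp: G_def max_def min_def)
    have "diag e (\<lambda>n. G k (l n)) = (\<Sum>n<Suc k. G k (l n) *\<^sub>R proj (e n))"
      by (rule diag_finite) (simp add: Gv)
    also have "\<dots> = (\<Sum>n<Suc k. (l k - l (Suc k)) *\<^sub>R proj (e n))" by (intro sum.cong) (simp_all add: Gv)
    finally show ?thesis by (simp only: scaleR_sum_right)
  qed
  have phiA: "\<phi> (A k) = (\<Sum>i<k. ennreal ((l i - l (Suc i)) * \<alpha> (Suc i)))" for k
  proof (induction k)
    case 0
    \<comment> \<open>The largest eigenvalue is \<open>l 0\<close>, so the first shift removes
      everything; \<phi>(0) = 0 comes from homogeneity with factor 0.\<close>
    have "F 0 (l n) = 0" for n using decseqD[OF e(3), of 0 n] by (simp add: F_def)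
    then have "A 0 = 0" by (simp add: A_def)
    moreover have "\<phi> (0 *\<^sub>R 0) = ennreal 0 * \<phi> 0"
      using hom zero_in_Kpos unfolding positively_homogeneous_def by blast
    ultimately show ?case by simp
  next
    case (Suc k)
    have mF: "mono_on S (F k)" and mG: "mono_on S (G k)" for S
      by (auto simp: mono_on_def F_def G_def max_def min_def)
    have "A (Suc k) = fun_calc (F k) ?a + fun_calc (G k) ?a"
      unfolding A_def Fc Gc FG by (rule diag_add[OF e(1) Fl Gl])
    then have "\<phi> (A (Suc k)) = \<phi> (fun_calc (F k) ?a) + \<phi> (fun_calc (G k) ?a)"
      using add aK FS mF mG unfolding monotonic_increasing_additive_def by metis
    also have "\<phi> (fun_calc (G k) ?a) = ennreal (l k - l (Suc k)) * \<phi> (\<Sum>i<Suc k. proj (e i))"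
      using hom dl[of k] sum_proj_in_Fpos[of "{..<Suc k}" e] Fpos_subset_Kpos
      unfolding Gc G positively_homogeneous_def by (metis diff_ge_0_iff_ge finite_lessThan subsetD)
    also have "\<dots> = ennreal ((l k - l (Suc k)) * \<alpha> (Suc k))"
      unfolding \<alpha>(1) using dl[of k] \<alpha>(2)[of "Suc k"] by (simp add: ennreal_mult)
    finally show ?case by (simp only: Fc A_def[symmetric] Suc.IH sum.lessThan_Suc)
  qed
  have AK: "A k \<in> Kpos" for k unfolding A_def by (rule diag_in_Kpos[OF e(1) Fl]) (simp add: F_def)
  have diff: "?a - A k = diag e (\<lambda>n. l n - F k (l n))" for k
    unfolding A_def by (rule diag_diff[OF e(1,2) Fl, symmetric])
  have dlim: "(\<lambda>n. l n - F k (l n)) \<longlonglongrightarrow> 0" for k using tendsto_diff[OF e(2) Fl] by simp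
  \<comment> \<open>The difference is the minimum of \<open>l n\<close> and \<open>l k\<close>:
    nonnegative, and at most \<open>l k\<close> uniformly in n.\<close>
  have db: "0 \<le> l n - F k (l n)" "l n - F k (l n) \<le> l k" for n k
    using l0[of n] l0[of k] by (auto simp: F_def max_def)
  have pos: "positive (?a - A k)" for k unfolding diff by (rule positive_diag[OF e(1) dlim db(1)])
  have "norm (A k - ?a) \<le> l k" for k
  proof -
    have "norm (?a - A k) \<le> l k" unfolding diff by (rule norm_diag_le[OF e(1) dlim]) (use db in \<open>simp add: abs_of_nonneg\<close>)
    then show ?thesis by (simp add: norm_minus_commute)
  qed
  then have "(\<lambda>k. A k - ?a) \<longlonglongrightarrow> 0" by (intro Lim_null_comparison[OF _ e(2)] always_eventually allI)
  then have Alim: "A \<longlonglongrightarrow> ?a" by (rule LIM_zero_cancel)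
  have "\<phi> ?a = (SUP k. \<phi> (A k))" by (rule monotone_lower_semicontinuous_limit[OF mon lsc aK AK pos Alim])
  also have "\<dots> = (\<Sum>n. ennreal ((l n - l (Suc n)) * \<alpha> (Suc n)))"
    unfolding phiA by (rule suminf_eq_SUP[symmetric])
  also have "\<dots> = choquet_trace \<alpha> ?a" by (simp add: choquet_trace_def eigval_diag[OF e])
  finally show ?thesis .
qed

lemma monotonic_increasing_additive_if_comonotonic_additive:
  assumes "comonotonic_additive \<phi>"
  shows "monotonic_increasing_additive \<phi>"
proof -
  have "comonotonic_on S f g" if "mono_on S f" "mono_on S g" for S :: "real set" and f g
    unfolding comonotonic_on_def
  proof (intro ballI)
    fix s t assume "s \<in> S" "t \<in> S"
    then show "0 \<le> (f s - f t) * (g s - g t)"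
      using that by (cases s t rule: le_cases) (auto simp: mono_on_def zero_le_mult_iff)
  qed
  then show ?thesis using assms unfolding comonotonic_additive_def monotonic_increasing_additive_def by blast
qed

theorem theorem2p8:
  fixes \<phi> :: "('a::complex_hilbert_space \<Rightarrow>\<^sub>L 'a) \<Rightarrow> ennreal"
  assumes separable: "separable_space (euclidean :: 'a topology)"
    and infinite_dim: "infinite_dimensional TYPE('a)"
  defines "cond1 \<equiv> (\<exists>\<alpha> :: nat \<Rightarrow> real. mono \<alpha> \<and> (\<forall>n. 0 \<le> \<alpha> n) \<and> \<alpha> 0 = 0 \<and>
                      (\<forall>a \<in> Kpos. \<phi> a = choquet_trace \<alpha> a))"
    and "cond2 \<equiv> monotonic_increasing_additive \<phi> \<and> unitarily_invariant \<phi> \<and> op_monotone \<phi> \<and>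
                  positively_homogeneous \<phi> \<and> lower_semicontinuous \<phi> \<and> (\<forall>a \<in> Fpos. \<phi> a < \<infinity>)"
    and "cond3 \<equiv> comonotonic_additive \<phi> \<and> unitarily_invariant \<phi> \<and> op_monotone \<phi> \<and>
                  positively_homogeneous \<phi> \<and> lower_semicontinuous \<phi> \<and> (\<forall>a \<in> Fpos. \<phi> a < \<infinity>)"
  shows "(cond1 \<longleftrightarrow> cond2) \<and> (cond2 \<longleftrightarrow> cond3)"
proof -
  \<comment> \<open>The cycle is (1), (3), (2), (1): the stronger additivity is what a Choquet trace
    is shown to have, and the weaker one is what recovers the weight.\<close>
  have 13: cond3 if cond1
  proof -
    obtain \<alpha> where \<alpha>: "mono \<alpha> \<and> (\<forall>n. 0 \<le> \<alpha> n) \<and> \<alpha> 0 = 0 \<and> (\<forall>a \<in> Kpos. \<phi> a = choquet_trace \<alpha> a)"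
      using \<open>cond1\<close> unfolding cond1_def ..
    then have "mono \<alpha>" "\<alpha> 0 = 0" "a \<in> Kpos \<Longrightarrow> \<phi> a = choquet_trace \<alpha> a" for a by simp_all
    note facts = infinite_dim this
    show ?thesis
      unfolding cond3_def
      by (intro conjI ballI choquet_comonotonic_additive[OF facts] choquet_unitarily_invariant[OF facts]
          choquet_monotone[OF facts] choquet_homogeneous[OF facts] choquet_lower_semicontinuous[OF facts]
          choquet_finite_rank[OF facts])
  qed
  have 32: cond2 if cond3
    using that monotonic_increasing_additive_if_comonotonic_additive unfolding cond2_def cond3_def by blast
  have 21: cond1 if cond2
  proof -
    have add: "monotonic_increasing_additive \<phi>" and uni: "unitarily_invariant \<phi>" and mon: "op_monotone \<phi>"
      and hom: "positively_homogeneous \<phi>" and lsc: "lower_semicontinuous \<phi>"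
      and fin: "\<And>a. a \<in> Fpos \<Longrightarrow> \<phi> a < \<infinity>"
      using that unfolding cond2_def by blast+
    \<comment> \<open>Any orthonormal sequence would do; diagonalising the zero operator yields
      one.\<close>
    obtain b :: "nat \<Rightarrow> 'a" where b: "orthonormal b"
      using compact_positive_diagonalizable[OF infinite_dim zero_in_Kpos] by blast
    \<comment> \<open>The conversion to a real loses nothing because \<phi> is finite on finite rank
      operators.\<close>
    define \<alpha> where "\<alpha> n = enn2real (\<phi> (\<Sum>i<n. proj (b i)))" for n
    have \<alpha>: "\<phi> (\<Sum>i<n. proj (b i)) = ennreal (\<alpha> n)" for n
      using fin[OF sum_proj_in_Fpos[of "{..<n}" b]] by (simp add: \<alpha>_def)
    have \<alpha>0: "0 \<le> \<alpha> n" for n by (simp add: \<alpha>_def)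
    have Q: "(\<Sum>i<n. proj (b i)) \<in> Kpos" for n
      using sum_proj_in_Fpos[of "{..<n}" b] Fpos_subset_Kpos by blast
    have "mono \<alpha>"
    proof (rule incseq_SucI)
      fix n
      have "\<phi> (\<Sum>i<n. proj (b i)) \<le> \<phi> (\<Sum>i<Suc n. proj (b i))"
        using mon Q[of n] Q[of "Suc n"] positive_proj[of "b n"] unfolding op_monotone_def by simp
      then show "\<alpha> n \<le> \<alpha> (Suc n)" using \<alpha>0 by (simp only: \<alpha> ennreal_le_iff)
    qed
    moreover have "\<alpha> 0 = 0"
    proof -
      have "\<phi> (0 *\<^sub>R 0) = ennreal 0 * \<phi> 0"
        using hom zero_in_Kpos unfolding positively_homogeneous_def by blast
      then show ?thesis by (simp add: \<alpha>_def)
    qed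
    moreover have "\<phi> a = choquet_trace \<alpha> a" if a: "a \<in> Kpos" for a
    proof -
      obtain e l where e: "orthonormal e" "l \<longlonglongrightarrow> 0" "decseq l" "a = diag e l"
        using Kpos_diagE[OF infinite_dim a] .
      \<comment> \<open>The weight was read off along \<open>b\<close>, whereas the eigenvectors
        \<open>e\<close> depend on \<open>a\<close>; unitary invariance bridges the two.\<close>
      have "\<phi> (\<Sum>i<n. proj (e i)) = ennreal (\<alpha> n)" for n
        using unitarily_invariant_projections[OF infinite_dim uni e(1) b] \<alpha> by simp
      then show ?thesis
        unfolding e(4) by (rule monotone_additive_eq_choquet_trace[OF add mon hom lsc e(1-3) _ \<alpha>0])
    qed
    ultimately show ?thesis using \<alpha>0 unfolding cond1_def by blast
  qed
  show ?thesis using 13 32 21 by blast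
qed

end
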